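(* Let $A,B$ and $S$ be non-empty subsets of a finite Abelian group $G$ with $|A|+|B|=|G|+L_S$ and $L_S=|S|\,L(G)$. Let $2b_s+s$ be an $A\wedge^S B$-exception with $s\in S$ and $b_s\in (A-s)\cap B$. Then the equality $|A\wedge^S B|=|G|-2|S|$ holds if and only if the following conditions hold: (i) $\Sigma=S-s$ is a subgroup of $G$; and, letting $\pi:G\to G/\Sigma$ be the natural projection, $A'=\pi(A-b_s-s)$ and $B'=\pi(B-b_s)$, (ii) there exists $b\in A'\cap B'$ such that $H=\langle 2b\rangle$ is a subgroup of $G/\Sigma$ of odd order $d$ greater than $1$; (iii) (for this $b$, $H$, $d$) there exist distinct elements $x_1,\ldots,x_k,x_{k+1},\ldots,x_l,x_{l+1},\ldots,x_m$ of $(G/\Sigma)\setminus (K(G/\Sigma)+H)$, where $m=(|G/\Sigma|/d-L(G/\Sigma))/2$ and $0\le k\le l\le m$, such that $$(G/\Sigma)\setminus (K(G/\Sigma)+H)=\bigcup_{i=1}^m\big((x_i+H)\cup(-x_i+H)\big),$$ $$A'=\big(\{0,b,3b,\ldots,(d-2)b\}+K(G/\Sigma)\big)\cup\big(\{x_1,\ldots,x_k,\pm x_{k+1},\ldots,\pm x_l\}+H\big),$$ $$B'=\big(\{0,b,3b,\ldots,(d-2)b\}+K(G/\Sigma)\big)\cup\big(\{x_1,\ldots,x_k,\pm x_{l+1},\ldots,\pm x_m\}+H\big);$$ (iv) $A=b_s+s+\pi^{-1}(A')$ and $B=b_s+\pi^{-1}(B')$.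
   Context: Groups are written additively. For subsets $A,B,S$ of a finite Abelian group $G$: $A+B=\{a+b: a\in A, b\in B\}$, $A-g=\{a-g:a\in A\}$ and $A\wedge^S B=\{a+b:\ a\in A,\ b\in B,\ a-b\notin S\}$. An $A\wedge^S B$-exception is an element of $(A+B)\setminus (A\wedge^S B)$. For $z\in G$, $L_S(z)=|\{(x,y)\in G\times G:\ x+y=z,\ x-y\in S\}|$, and $L_S=\max_{z\in G}L_S(z)$. For any finite Abelian group $\Gamma$, $K(\Gamma)=\{g\in \Gamma: 2g=0\}$ and $L(\Gamma)=|K(\Gamma)|$. The set $\{0,b,3b,\ldots,(d-2)b\}$ consists of $0$ and the odd multiples $jb$ with $1\le j\le d-2$, $j$ odd. *)

theory Defs
  imports "HOL-Algebra.Algebra"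
begin

text \<open>
  HOL-Algebra writes groups multiplicatively: a sum \<open>a + b\<close> appears as \<open>a \<otimes> b\<close>, a multiple
  \<open>j b\<close> as \<open>b [^] j\<close>, the sumset \<open>A + B\<close> as \<open>A <#> B\<close>, and the translate \<open>A - g\<close>
  as \<open>A #> inv g\<close>.
\<close>

definition restricted_sumset ::
    "('a, 'b) monoid_scheme \<Rightarrow> 'a set \<Rightarrow> 'a set \<Rightarrow> 'a set \<Rightarrow> 'a set" where
  "restricted_sumset G S A B =
     {a \<otimes>\<^bsub>G\<^esub> b | a b. a \<in> A \<and> b \<in> B \<and> a \<otimes>\<^bsub>G\<^esub> inv\<^bsub>G\<^esub> b \<notin> S}"

definition exceptions ::
    "('a, 'b) monoid_scheme \<Rightarrow> 'a set \<Rightarrow> 'a set \<Rightarrow> 'a set \<Rightarrow> 'a set" where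
  "exceptions G S A B = (A <#>\<^bsub>G\<^esub> B) - restricted_sumset G S A B"

definition L_at :: "('a, 'b) monoid_scheme \<Rightarrow> 'a set \<Rightarrow> 'a \<Rightarrow> nat" where
  "L_at G S z = card {(x, y) \<in> carrier G \<times> carrier G.
     x \<otimes>\<^bsub>G\<^esub> y = z \<and> x \<otimes>\<^bsub>G\<^esub> inv\<^bsub>G\<^esub> y \<in> S}"

definition L_max :: "('a, 'b) monoid_scheme \<Rightarrow> 'a set \<Rightarrow> nat" where
  "L_max G S = Max (L_at G S ` carrier G)"

definition two_torsion :: "('a, 'b) monoid_scheme \<Rightarrow> 'a set" where
  "two_torsion G = {g \<in> carrier G. g [^]\<^bsub>G\<^esub> (2::nat) = \<one>\<^bsub>G\<^esub>}"

definition L_group :: "('a, 'b) monoid_scheme \<Rightarrow> nat" where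
  "L_group G = card (two_torsion G)"

text \<open>The set \<open>{0, b, 3b, \<dots>, (d - 2)b}\<close>; it is used only for odd \<open>d > 1\<close>, where the
  subtraction on \<open>nat\<close> does not truncate.\<close>

definition zero_and_odd_multiples :: "('a, 'b) monoid_scheme \<Rightarrow> 'a \<Rightarrow> nat \<Rightarrow> 'a set" where
  "zero_and_odd_multiples G b d =
     {\<one>\<^bsub>G\<^esub>} \<union> {b [^]\<^bsub>G\<^esub> j | j::nat. odd j \<and> 1 \<le> j \<and> j \<le> d - 2}"

end

theory Submission
  imports Defs
begin

text \<open>
  After a translation the given exception is \<open>\<one>\<close> and \<open>S\<close> becomes \<open>\<Sigma> \<ni> \<one>\<close>. Since
  \<open>|A| + |B| = |G| + |S| L(G)\<close>, an element \<open>z\<close> is an exception if and only if every \<open>y\<close> satisfies the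
  identity of indicators \<open>[y\<inverse> \<in> B] = [y z \<notin> A] + [y\<^sup>2 z \<in> \<Sigma>]\<close>. Comparing it for two exceptions
  \<open>z\<close>, \<open>w\<close> gives a relation between translates of \<open>\<Sigma>\<close> which shows that the set \<open>E\<close> of exceptions either
  consists of common periods of \<open>B\<close> and \<open>\<Sigma>\<close> or is covered by a translate of \<open>\<Sigma>\<close> and a translate of
  \<open>\<Sigma>\<inverse>\<close> that are exchanged by \<open>x \<mapsto> z x\<inverse>\<close>. Hence \<open>|E| \<le> 2 |\<Sigma>|\<close>; in case of equality \<open>E\<close> is
  invariant under these reflections, so that any two exceptions that are not periods differ by a
  period, which forces \<open>\<Sigma>\<close> to be the group of periods.

  Modulo \<open>\<Sigma>\<close> there are then exactly two exceptions, \<open>\<one>\<close> and \<open>z\<close>, and the two identities determine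
  how membership in \<open>A\<close> changes from \<open>y\<close> to \<open>y z\<close>. Walking along the cosets of \<open>\<langle>z\<rangle>\<close> yields the
  odd order of \<open>z\<close> and the shape of \<open>A\<close> and \<open>B\<close>. Conversely, that shape makes the classes of \<open>\<one>\<close> and
  \<open>b\<^sup>2\<close> consist of exceptions, and the bound on \<open>|E|\<close> leaves no others.
\<close>

section \<open>Exceptions as exact representations\<close>

text \<open>The pairs \<open>(y \<otimes> z, inv y)\<close> are all the pairs with sum
  \<open>z\<close>, and \<open>y \<otimes> y \<otimes> z\<close> is their difference. The identity
  says that a pair with difference in \<open>S\<close> lies in \<open>A \<times> B\<close>, while
  any other pair has exactly one entry in its set. It is stated over the integers so that instances
  of it can be subtracted and summed over \<open>y\<close>.\<close>

definition exact_at ::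
    "('a, 'b) monoid_scheme \<Rightarrow> 'a set \<Rightarrow> 'a set \<Rightarrow> 'a set \<Rightarrow> 'a \<Rightarrow> bool" where
  "exact_at G S A B z \<longleftrightarrow> (\<forall>y \<in> carrier G. (of_bool (inv\<^bsub>G\<^esub> y \<in> B) :: int) =
     of_bool (y \<otimes>\<^bsub>G\<^esub> z \<notin> A) + of_bool (y \<otimes>\<^bsub>G\<^esub> y \<otimes>\<^bsub>G\<^esub> z \<in> S))"

section \<open>Square roots and translates in a finite Abelian group\<close>

context comm_group
begin

lemma mult_inv_cancel [simp]:
  assumes "x \<in> carrier G" "y \<in> carrier G"
  shows "x \<otimes> (inv x \<otimes> y) = y" and "inv x \<otimes> (x \<otimes> y) = y"
    and "y \<otimes> x \<otimes> inv x = y" and "y \<otimes> inv x \<otimes> x = y"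
    and "x \<otimes> y \<otimes> inv x = y"
proof -
  show "x \<otimes> (inv x \<otimes> y) = y" "inv x \<otimes> (x \<otimes> y) = y"
    using assms by (simp_all add: m_assoc[symmetric])
  show yx: "y \<otimes> x \<otimes> inv x = y" "y \<otimes> inv x \<otimes> x = y"
    using assms by (simp_all add: m_assoc)
  show "x \<otimes> y \<otimes> inv x = y" using yx assms by (simp add: m_comm)
qed

lemma two_torsion_iff: "x \<in> two_torsion G \<longleftrightarrow> x \<in> carrier G \<and> x \<otimes> x = \<one>"
  by (auto simp: two_torsion_def numeral_2_eq_2)

text \<open>Two solutions differ by a 2-torsion element, so dividing by a fixed solution maps the
  fibre injectively into \<open>two_torsion G\<close>.\<close>

lemma card_square_fibre_le:
  assumes fin: "finite (carrier G)" and c: "z \<in> carrier G"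
  shows "card {y \<in> carrier G. y \<otimes> y \<otimes> z = t} \<le> L_group G"
proof (cases "{y \<in> carrier G. y \<otimes> y \<otimes> z = t} = {}")
  case False
  then obtain u where u: "u \<in> carrier G" "u \<otimes> u \<otimes> z = t" by blast
  have "y \<otimes> inv u \<in> two_torsion G" if y: "y \<in> carrier G" "y \<otimes> y \<otimes> z = t" for y
  proof -
    have "y \<otimes> y = u \<otimes> u" using u y c by (metis m_closed r_cancel)
    moreover have "y \<otimes> inv u \<otimes> (y \<otimes> inv u) = (y \<otimes> y) \<otimes> inv (u \<otimes> u)"
      using u y by (simp add: inv_mult m_ac)
    ultimately show ?thesis using u y by (simp add: two_torsion_iff)
  qed
  moreover have "inj_on (\<lambda>y. y \<otimes> inv u) {y \<in> carrier G. y \<otimes> y \<otimes> z = t}"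
    using u by (auto intro!: inj_onI)
  moreover have "finite (two_torsion G)" using fin by (simp add: two_torsion_def)
  ultimately show ?thesis unfolding L_group_def by (intro card_inj_on_le) auto
qed (simp only: card.empty)

lemma L_group_pos: "finite (carrier G) \<Longrightarrow> L_group G > 0"
  unfolding L_group_def by (subst card_gt_0_iff) (auto simp: two_torsion_def)

lemma card_translate_preimage:
  assumes "U \<subseteq> carrier G" "z \<in> carrier G"
  shows "card {y \<in> carrier G. y \<otimes> z \<in> U} = card U"
proof -
  have "bij_betw (\<lambda>y. y \<otimes> z) {y \<in> carrier G. y \<otimes> z \<in> U} U"
    using assms by (intro bij_betwI[where g = "\<lambda>x. x \<otimes> inv z"]) (auto simp: m_assoc)
  then show ?thesis by (rule bij_betw_same_card)
qed

lemma card_inv_preimage: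
  assumes "U \<subseteq> carrier G"
  shows "card {y \<in> carrier G. inv y \<in> U} = card U"
proof -
  have "bij_betw (\<lambda>y. inv y) {y \<in> carrier G. inv y \<in> U} U"
    using assms by (intro bij_betwI[where g = "\<lambda>x. inv x"]) auto
  then show ?thesis by (rule bij_betw_same_card)
qed

section \<open>Exceptions under the cardinality hypothesis\<close>

context
  fixes S A B :: "'a set"
  assumes fin: "finite (carrier G)"
    and A: "A \<subseteq> carrier G" and B: "B \<subseteq> carrier G" and S: "S \<subseteq> carrier G" and S0: "S \<noteq> {}"
    and cards: "card A + card B = order G + card S * L_group G"
begin

lemma card_translate_compl:
  assumes "z \<in> carrier G"
  shows "card {y \<in> carrier G. y \<otimes> z \<notin> A} + card A = order G"
proof -
  have "{y \<in> carrier G. y \<otimes> z \<notin> A} = carrier G - {y \<in> carrier G. y \<otimes> z \<in> A}" by auto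
  then have "card {y \<in> carrier G. y \<otimes> z \<notin> A} = order G - card A"
    using assms A fin by (simp add: card_Diff_subset card_translate_preimage order_def)
  then show ?thesis using card_mono[OF fin A] by (simp add: order_def)
qed

text \<open>If \<open>z\<close> were not a sum, then \<open>A\<close> and the reflection of
  \<open>B\<close> through \<open>z\<close> would be disjoint, giving |A| + |B| \<le> |G|; but the
  surplus |S| L(G) is positive.\<close>

lemma set_mult_eq_carrier: "A <#> B = carrier G"
proof
  show "carrier G \<subseteq> A <#> B"
  proof
    fix z assume z: "z \<in> carrier G"
    show "z \<in> A <#> B"
    proof (rule ccontr)
      assume n: "z \<notin> A <#> B"
      have "y \<otimes> z \<notin> A" if y: "y \<in> carrier G" "inv y \<in> B" for y
      proof
        assume "y \<otimes> z \<in> A"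
        then have "(y \<otimes> z) \<otimes> inv y \<in> A <#> B" using y by (auto simp: set_mult_def)
        moreover have "(y \<otimes> z) \<otimes> inv y = z" using y z by simp
        ultimately show False using n by simp
      qed
      then have "card {y \<in> carrier G. inv y \<in> B} \<le> card {y \<in> carrier G. y \<otimes> z \<notin> A}"
        using fin by (intro card_mono) auto
      moreover have "card S > 0" using S0 S fin by (metis card_gt_0_iff finite_subset)
      then have "card S * L_group G > 0" using L_group_pos fin by simp
      ultimately show False
        using card_translate_compl[OF z] cards card_inv_preimage[OF B] by linarith
    qed
  qed
qed (use A B in \<open>auto simp: set_mult_def\<close>)

text \<open>As \<open>A <#> B\<close> is the whole group, the exceptions form the complement of the
  restricted sumset.\<close>

lemma card_restricted_sumset:
  "card (restricted_sumset G S A B) + card (exceptions G S A B) = order G"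
proof -
  have sub: "restricted_sumset G S A B \<subseteq> carrier G"
    using A B by (auto simp: restricted_sumset_def)
  then have "card (carrier G - restricted_sumset G S A B)
      = order G - card (restricted_sumset G S A B)"
    using fin by (metis card_Diff_subset finite_subset order_def)
  then show ?thesis
    using card_mono[OF fin sub] by (simp add: exceptions_def set_mult_eq_carrier order_def)
qed

text \<open>For a representation \<open>z = a \<otimes> b\<close> take \<open>y = inv b\<close>: the
  left side of the identity is 1 and the first term on the right is 0, so the difference of
  \<open>a\<close> and \<open>b\<close> lies in \<open>S\<close>.\<close>

lemma exact_at_imp_exception:
  assumes z: "z \<in> carrier G" and ex: "exact_at G S A B z"
  shows "z \<in> exceptions G S A B"
proof -
  have "a \<otimes> inv b \<in> S" if ab: "a \<in> A" "b \<in> B" "z = a \<otimes> b" for a b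
  proof -
    have c: "a \<in> carrier G" "b \<in> carrier G" using ab A B by auto
    have "inv b \<otimes> z = a" "inv b \<otimes> inv b \<otimes> z = a \<otimes> inv b"
      using c ab(3) by (simp_all add: m_ac)
    then show ?thesis
      using bspec[OF ex[unfolded exact_at_def], of "inv b"] c ab by (auto split: if_splits)
  qed
  then show ?thesis
    using z by (auto simp: exceptions_def set_mult_eq_carrier restricted_sumset_def)
qed

text \<open>Summed over all \<open>y\<close>, the obvious pointwise inequality has equal sides, so it is an
  equality everywhere, and the bound on the square fibres is attained too.\<close>

lemma exceptionD:
  assumes "z \<in> exceptions G S A B"
  shows "exact_at G S A B z" and "\<forall>t \<in> S. \<exists>y \<in> carrier G. y \<otimes> y \<otimes> z = t"
proof -
  have z: "z \<in> carrier G" using assms by (auto simp: exceptions_def set_mult_eq_carrier)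
  let ?f = "\<lambda>y. of_bool (inv y \<in> B) :: int"
  let ?g = "\<lambda>y. of_bool (y \<otimes> z \<notin> A) + of_bool (y \<otimes> y \<otimes> z \<in> S) :: int"
  have le: "?f y \<le> ?g y" if y: "y \<in> carrier G" for y
  proof -
    have "y \<otimes> y \<otimes> z \<in> S" if h: "inv y \<in> B" "y \<otimes> z \<in> A"
    proof (rule ccontr)
      assume "y \<otimes> y \<otimes> z \<notin> S"
      moreover have "(y \<otimes> z) \<otimes> inv (inv y) = y \<otimes> y \<otimes> z" "(y \<otimes> z) \<otimes> inv y = z"
        using y z by (simp add: m_ac, simp)
      ultimately have "z \<in> restricted_sumset G S A B"
        using h unfolding restricted_sumset_def by (smt (verit) mem_Collect_eq)
      then show False using assms by (simp add: exceptions_def)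
    qed
    then show ?thesis by auto
  qed
  have sum_card: "(\<Sum>y\<in>carrier G. of_bool (P y) :: int) = int (card {y \<in> carrier G. P y})" for P
    using fin by (simp add: Collect_conj_eq of_bool_def sum.If_cases)
  let ?U = "\<lambda>t. {y \<in> carrier G. y \<otimes> y \<otimes> z = t}"
  let ?V = "{y \<in> carrier G. y \<otimes> y \<otimes> z \<in> S}"
  have finS: "finite S" using S fin finite_subset by blast
  \<comment> \<open>\<open>T\<close> is left free because the bound is used twice: with all of
    \<open>S\<close>, and with \<open>S\<close> minus an element whose fibre is empty.\<close>
  have V_le: "card ?V \<le> card T * L_group G" if T: "?V = (\<Union>t\<in>T. ?U t)" "finite T" for T
  proof -
    have "card ?V \<le> (\<Sum>t\<in>T. card (?U t))" unfolding T(1) by (rule card_UN_le[OF T(2)])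
    also have "\<dots> \<le> card T * L_group G"
      using sum_bounded_above[of T "\<lambda>t. card (?U t)" "L_group G"] card_square_fibre_le[OF fin z]
      by simp
    finally show ?thesis .
  qed
  have VS: "card ?V \<le> card S * L_group G" by (rule V_le) (use finS in auto)
  have sf: "(\<Sum>y\<in>carrier G. ?f y) = int (card B)"
    using card_inv_preimage[OF B] by (simp only: sum_card)
  have sg: "(\<Sum>y\<in>carrier G. ?g y) = int (order G) - int (card A) + int (card ?V)"
    using card_translate_compl[OF z] by (simp only: sum.distrib sum_card)
  have sfg: "(\<Sum>y\<in>carrier G. ?f y) \<le> (\<Sum>y\<in>carrier G. ?g y)" by (rule sum_mono[OF le])
  have cards': "int (card A) + int (card B) = int (order G) + int (card S * L_group G)"
    using cards by linarith
  have V: "card ?V = card S * L_group G" using VS sf sg sfg cards' by linarith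
  have eq: "(\<Sum>y\<in>carrier G. ?f y) = (\<Sum>y\<in>carrier G. ?g y)"
    using V sf sg cards' by linarith
  have "?f y = ?g y" if y: "y \<in> carrier G" for y
    by (rule sum_mono_inv[OF eq le y fin])
  then show "exact_at G S A B z" by (simp add: exact_at_def)
  show "\<forall>t \<in> S. \<exists>y \<in> carrier G. y \<otimes> y \<otimes> z = t"
  proof (rule ccontr)
    assume "\<not> ?thesis"
    then obtain t where t: "t \<in> S" "?U t = {}" by blast
    then have "?V = (\<Union>t'\<in>S - {t}. ?U t')" by auto
    from V_le[OF this] finS have "card S * L_group G \<le> card (S - {t}) * L_group G"
      by (simp only: V finite_Diff)
    moreover have "card (S - {t}) < card S" by (rule card_Diff1_less[OF finS t(1)])
    ultimately show False using L_group_pos[OF fin] by simp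
  qed
qed

end

end

section \<open>The number of exceptions\<close>

context comm_group
begin

section \<open>Relations between exceptions once one of them is \<open>\<one>\<close>\<close>

context
  fixes S A B E :: "'a set"
  assumes fin: "finite (carrier G)" and S: "S \<subseteq> carrier G" and one_S: "\<one> \<in> S"
    and E_def: "E = {z \<in> carrier G. exact_at G S A B z}"
    and one_E: "\<one> \<in> E"
    and square: "\<And>z t. z \<in> E \<Longrightarrow> t \<in> S \<Longrightarrow> \<exists>y \<in> carrier G. y \<otimes> y \<otimes> z = t"
begin

private abbreviation c :: "'a \<Rightarrow> int" where "c y \<equiv> of_bool (inv y \<in> B)"
private abbreviation t :: "'a \<Rightarrow> int" where "t y \<equiv> of_bool (y \<in> S)"
private abbreviation D :: "'a \<Rightarrow> int" where "D y \<equiv> of_bool (y \<notin> A)"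

text \<open>Periods of \<open>A\<close> follow from these two conditions through the identity at
  \<open>\<one>\<close>. The inverse in the first condition matches the form in which
  \<open>B\<close> enters \<open>exact_at\<close>.\<close>

definition common_periods :: "'a set" where
  "common_periods = {p \<in> carrier G. (\<forall>y \<in> carrier G. inv (y \<otimes> p) \<in> B \<longleftrightarrow> inv y \<in> B) \<and>
     (\<forall>y \<in> carrier G. y \<otimes> p \<in> S \<longleftrightarrow> y \<in> S)}"

private lemma E_carrier: "z \<in> E \<Longrightarrow> z \<in> carrier G"
  by (simp add: E_def)

private lemma exact:
  "z \<in> E \<Longrightarrow> y \<in> carrier G \<Longrightarrow> c y = D (y \<otimes> z) + t (y \<otimes> y \<otimes> z)"
  by (auto simp: E_def exact_at_def)

private lemma exact_one: "y \<in> carrier G \<Longrightarrow> c y = D y + t (y \<otimes> y)"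
  using exact[OF one_E, of y] by simp

text \<open>The identity of \<open>z\<close> at \<open>y\<close> and that of \<open>\<one>\<close>
  at \<open>y \<otimes> z\<close> both contain \<open>D (y \<otimes> z)\<close>; subtracting them
  eliminates \<open>A\<close>.\<close>

private lemma step:
  assumes "z \<in> E" "y \<in> carrier G"
  shows "c y + t (y \<otimes> y \<otimes> (z \<otimes> z)) = c (y \<otimes> z) + t (y \<otimes> y \<otimes> z)"
proof -
  have "y \<otimes> z \<otimes> (y \<otimes> z) = y \<otimes> y \<otimes> (z \<otimes> z)"
    using assms E_carrier by (simp add: m_ac)
  then show ?thesis
    using exact[OF assms] exact_one[of "y \<otimes> z"] assms E_carrier by simp
qed

lemma finite_S: "finite S"
  using S fin finite_subset by blast

text \<open>Translation by \<open>p\<close> is injective, so if it maps the finite set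
  \<open>S\<close> into itself, it is a bijection of \<open>S\<close>; this gives the other
  direction.\<close>

lemma periodI:
  assumes p: "p \<in> carrier G" and sub: "\<And>u. u \<in> S \<Longrightarrow> u \<otimes> p \<in> S" and y: "y \<in> carrier G"
  shows "y \<otimes> p \<in> S \<longleftrightarrow> y \<in> S"
proof
  have "inj_on (\<lambda>u. u \<otimes> p) S" using p S by (auto intro!: inj_onI simp: subset_iff)
  then have "(\<lambda>u. u \<otimes> p) ` S = S"
    using sub finite_S by (intro endo_inj_surj) auto
  moreover assume "y \<otimes> p \<in> S"
  ultimately obtain u where "u \<in> S" "y \<otimes> p = u \<otimes> p" by (metis imageE)
  then show "y \<in> S" using p S y by auto
qed (use sub in auto)

text \<open>Translating by \<open>z\<close> and by \<open>w\<close> in the two possible orders gives a relation in the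
  group ring between six translates of \<open>S\<close> only.\<close>

lemma exception_relation:
  assumes z: "z \<in> E" and w: "w \<in> E" and u: "u \<in> S"
  shows "u \<otimes> (z \<otimes> z) \<in> S \<or> u \<otimes> w \<in> S \<or> (\<exists>v \<in> S. u \<otimes> z = v \<otimes> w)"
proof -
  \<comment> \<open>Solvability of the square equation at the exception \<open>w\<close> allows
    \<open>y \<otimes> y \<otimes> w = u\<close>, so that one term of the relation equals 1.\<close>
  obtain y where y: "y \<in> carrier G" and yu: "y \<otimes> y \<otimes> w = u" using square[OF w u] by blast
  have zc: "z \<in> carrier G" and wc: "w \<in> carrier G" using z w E_carrier by auto
  note 1 = step[OF z y] and 2 = step[OF w y]
  have "c (y \<otimes> w) + t (y \<otimes> y \<otimes> (w \<otimes> w) \<otimes> (z \<otimes> z))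
      = c (y \<otimes> w \<otimes> z) + t (y \<otimes> y \<otimes> (w \<otimes> w) \<otimes> z)"
    using step[OF z, of "y \<otimes> w"] y zc wc by (simp add: m_ac)
  moreover have "c (y \<otimes> z) + t (y \<otimes> y \<otimes> (w \<otimes> w) \<otimes> (z \<otimes> z))
      = c (y \<otimes> w \<otimes> z) + t (y \<otimes> y \<otimes> w \<otimes> (z \<otimes> z))"
    using step[OF w, of "y \<otimes> z"] y zc wc by (simp add: m_ac)
  moreover have "t (y \<otimes> y \<otimes> w) = 1" using yu u by simp
  \<comment> \<open>With products abbreviated, eliminating \<open>c\<close> from the four steps
    gives t(yyz) + t(yyww) + t(yywzz) = t(yyw) + t(yyzz) + t(yywwz). The right side is at least 1,
    so some term on the left is 1.\<close>
  ultimately have "t (y \<otimes> y \<otimes> w \<otimes> (z \<otimes> z)) = 1 \<or> t (y \<otimes> y \<otimes> (w \<otimes> w)) = 1 \<or>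
      t (y \<otimes> y \<otimes> z) = 1"
    using 1 2 by (auto simp only: of_bool_def split: if_splits)
  then have "u \<otimes> (z \<otimes> z) \<in> S \<or> u \<otimes> w \<in> S \<or> y \<otimes> y \<otimes> z \<in> S"
    using y zc wc unfolding yu[symmetric] by (auto simp: m_assoc split: if_splits)
  moreover have "u \<otimes> z = (y \<otimes> y \<otimes> z) \<otimes> w" unfolding yu[symmetric] using y zc wc by (simp add: m_ac)
  ultimately show ?thesis by blast
qed

text \<open>Every element of \<open>S\<close> is a square because \<open>\<one>\<close> is an
  exception, so invariance on squares covers all of \<open>S\<close>; \<open>periodI\<close> extends
  it to the group.\<close>

lemma period_of_squares:
  assumes p: "p \<in> carrier G" and tp: "\<And>y. y \<in> carrier G \<Longrightarrow> t (y \<otimes> y \<otimes> p) = t (y \<otimes> y)"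
    and x: "x \<in> carrier G"
  shows "x \<otimes> p \<in> S \<longleftrightarrow> x \<in> S"
proof (rule periodI[OF p _ x])
  fix u assume u: "u \<in> S"
  obtain y where y: "y \<in> carrier G" "y \<otimes> y = u" using square[OF one_E u] by auto
  then show "u \<otimes> p \<in> S" using tp[OF y(1)] u by (simp split: if_splits)
qed

lemma common_periodI:
  assumes p: "p \<in> carrier G" and tp: "\<And>y. y \<in> carrier G \<Longrightarrow> t (y \<otimes> y \<otimes> p) = t (y \<otimes> y)"
    and cp: "\<And>y. y \<in> carrier G \<Longrightarrow> c (y \<otimes> p) = c y"
  shows "p \<in> common_periods"
  using p cp period_of_squares[OF p tp] by (simp add: common_periods_def of_bool_eq_iff)

text \<open>Two steps by \<open>z\<close> change the indicator of \<open>B\<close> by an even number, hence by \<open>0\<close>.\<close>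

lemma square_period_imp_period:
  assumes z: "z \<in> E" and sub: "\<And>u. u \<in> S \<Longrightarrow> u \<otimes> (z \<otimes> z) \<in> S"
  shows "z \<in> common_periods"
proof -
  have zc: "z \<in> carrier G" using z E_carrier by auto
  have per: "t (y \<otimes> (z \<otimes> z)) = t y" if "y \<in> carrier G" for y
    using periodI[OF _ sub that] zc by simp
  have 1: "c y + t (y \<otimes> y) = c (y \<otimes> z) + t (y \<otimes> y \<otimes> z)" if y: "y \<in> carrier G" for y
    using step[OF z y] per[of "y \<otimes> y"] y by simp
  have 2: "c (y \<otimes> z) + t (y \<otimes> y) = c (y \<otimes> z \<otimes> z) + t (y \<otimes> y \<otimes> z)" if y: "y \<in> carrier G" for y
  proof -
    have "y \<otimes> z \<otimes> (y \<otimes> z) = y \<otimes> y \<otimes> (z \<otimes> z)"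
      "y \<otimes> z \<otimes> (y \<otimes> z) \<otimes> z = y \<otimes> y \<otimes> z \<otimes> (z \<otimes> z)"
      using y zc by (simp_all add: m_ac)
    then show ?thesis using 1[of "y \<otimes> z"] per[of "y \<otimes> y"] per[of "y \<otimes> y \<otimes> z"] y zc by simp
  qed
  have "t (y \<otimes> y \<otimes> z) = t (y \<otimes> y) \<and> c (y \<otimes> z) = c y" if y: "y \<in> carrier G" for y
    using 1[OF y] 2[OF y] by (auto simp only: of_bool_def split: if_splits)
  then show ?thesis using common_periodI[OF zc] by blast
qed

text \<open>Non-membership in \<open>A\<close> passes along translation by \<open>q\<close> in both
  directions, so \<open>q\<close> is a period of \<open>A\<close>. Comparing the identities of
  \<open>q\<close> and \<open>\<one>\<close> makes it a period of \<open>S\<close>, first on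
  squares, and then of \<open>B\<close>.\<close>

lemma exception_inv_imp_period:
  assumes q: "q \<in> E" and iq: "inv q \<in> E"
  shows "q \<in> common_periods"
proof -
  have qc: "q \<in> carrier G" using q E_carrier by auto
  \<comment> \<open>If \<open>D (y \<otimes> r) = 1\<close>, the identity of \<open>r\<close> at
    \<open>y\<close> gives \<open>t (y \<otimes> y \<otimes> r) = 0\<close> and that of
    \<open>\<one>\<close> at \<open>y \<otimes> r\<close> gives
    \<open>c (y \<otimes> r) = 1\<close>; the identity of \<open>inv r\<close> at
    \<open>y \<otimes> r\<close> then reads \<open>1 = D y\<close>.\<close>
  have mono: "D (y \<otimes> r) = 1 \<Longrightarrow> D y = 1" if r: "r \<in> E" "inv r \<in> E" and y: "y \<in> carrier G" for r y
  proof -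
    have rc: "r \<in> carrier G" using r E_carrier by auto
    have 1: "y \<otimes> r \<otimes> inv r = y" "y \<otimes> r \<otimes> (y \<otimes> r) \<otimes> inv r = y \<otimes> y \<otimes> r"
      using y rc by (simp_all add: m_assoc) (simp add: m_ac)
    have "y \<otimes> r \<in> carrier G" using y rc by simp
    note 2 = exact_one[OF this] exact[OF r(2) this]
    show "D (y \<otimes> r) = 1 \<Longrightarrow> D y = 1"
      using exact[OF r(1) y] exact_one[OF y] 2
      unfolding 1 by (auto simp only: of_bool_def split: if_splits)
  qed
  have Dq: "D (y \<otimes> q) = D y" if y: "y \<in> carrier G" for y
  proof -
    have "y \<otimes> q \<otimes> inv q = y" using y qc by (simp add: m_assoc)
    then show ?thesis
      using mono[OF q iq y] mono[OF iq, of "y \<otimes> q"] q qc y by (auto split: if_splits)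
  qed
  have tq: "t (y \<otimes> y \<otimes> q) = t (y \<otimes> y)" if y: "y \<in> carrier G" for y
    using exact[OF q y] exact_one[OF y] Dq[OF y] by linarith
  have cq: "c (y \<otimes> q) = c y" if y: "y \<in> carrier G" for y
  proof -
    have "y \<otimes> q \<otimes> (y \<otimes> q) = y \<otimes> y \<otimes> q \<otimes> q" using y qc by (simp add: m_ac)
    then have "t (y \<otimes> q \<otimes> (y \<otimes> q)) = t (y \<otimes> y)"
      using period_of_squares[OF qc tq] y qc by simp
    then show ?thesis using exact_one[of "y \<otimes> q"] exact_one[OF y] Dq[OF y] y qc by simp
  qed
  show ?thesis using common_periodI[OF qc tq cq] by blast
qed

section \<open>Periods and the size of the set of exceptions\<close>

lemma common_periods_subset: "common_periods \<subseteq> S"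
  using one_S by (auto simp: common_periods_def dest!: bspec[where x = \<one>])

lemma subgroup_common_periods: "subgroup common_periods G"
proof (rule subgroupI)
  show "common_periods \<noteq> {}" using m_closed by (auto simp: common_periods_def)
next
  fix a assume a: "a \<in> common_periods"
  then have ac: "a \<in> carrier G" by (simp add: common_periods_def)
  have "inv (y \<otimes> inv a) \<in> B \<longleftrightarrow> inv y \<in> B" "y \<otimes> inv a \<in> S \<longleftrightarrow> y \<in> S" if y: "y \<in> carrier G" for y
  proof -
    have "y \<otimes> inv a \<otimes> a = y" using y ac by (simp add: m_assoc)
    then show "inv (y \<otimes> inv a) \<in> B \<longleftrightarrow> inv y \<in> B" "y \<otimes> inv a \<in> S \<longleftrightarrow> y \<in> S"
      using a y ac unfolding common_periods_def by (metis (mono_tags, lifting) inv_closed m_closed mem_Collect_eq)+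
  qed
  then show "inv a \<in> common_periods" using ac by (simp add: common_periods_def)
next
  fix a b assume ab: "a \<in> common_periods" "b \<in> common_periods"
  then have "a \<in> carrier G" "b \<in> carrier G" by (simp_all add: common_periods_def)
  then show "a \<otimes> b \<in> common_periods"
    using ab by (auto simp: common_periods_def m_assoc[symmetric])
qed (auto simp: common_periods_def)

text \<open>By \<open>square_period_imp_period\<close> some \<open>u \<in> S\<close> leaves
  \<open>S\<close> under translation by \<open>z \<otimes> z\<close>. For this \<open>u\<close> the
  first alternative of \<open>exception_relation\<close> is void, and the other two place every
  exception in one of the two sets.\<close>

lemma exceptions_two_translates:
  assumes z: "z \<in> E" "z \<notin> common_periods"
  obtains u where "u \<in> S"
    "E \<subseteq> (\<lambda>v. v \<otimes> inv u) ` S \<union> (\<lambda>v. u \<otimes> z \<otimes> inv v) ` S"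
proof -
  obtain u where u: "u \<in> S" "u \<otimes> (z \<otimes> z) \<notin> S" using square_period_imp_period z by blast
  have uc: "u \<in> carrier G" and zc: "z \<in> carrier G" using u S z E_carrier by auto
  have "w \<in> (\<lambda>v. v \<otimes> inv u) ` S \<union> (\<lambda>v. u \<otimes> z \<otimes> inv v) ` S" if w: "w \<in> E" for w
  proof -
    have wc: "w \<in> carrier G" using w E_carrier by auto
    consider "u \<otimes> w \<in> S" | v where "v \<in> S" "u \<otimes> z = v \<otimes> w"
      using exception_relation[OF z(1) w u(1)] u(2) by blast
    then show ?thesis
    proof cases
      case 1
      have "w = (u \<otimes> w) \<otimes> inv u" using uc wc by simp
      then show ?thesis using 1 by blast
    next
      case 2
      then have "v \<in> carrier G" using S by auto
      then have "w = u \<otimes> z \<otimes> inv v" unfolding 2(2) using wc by simp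
      then show ?thesis using 2 by blast
    qed
  qed
  then show ?thesis using that u(1) by blast
qed

text \<open>Either all exceptions are common periods, of which there are at most |S|, or two sets of
  size at most |S| cover them.\<close>

lemma card_exceptions_le: "card E \<le> 2 * card S"
proof (cases "E \<subseteq> common_periods")
  case True
  then have "card E \<le> card S" using common_periods_subset finite_S by (meson card_mono order_trans)
  then show ?thesis by simp
next
  case False
  then obtain z where z: "z \<in> E" "z \<notin> common_periods" by blast
  then obtain u where "E \<subseteq> (\<lambda>v. v \<otimes> inv u) ` S \<union> (\<lambda>v. u \<otimes> z \<otimes> inv v) ` S"
    using exceptions_two_translates by blast
  then have "card E \<le> card ((\<lambda>v. v \<otimes> inv u) ` S \<union> (\<lambda>v. u \<otimes> z \<otimes> inv v) ` S)"
    using finite_S by (intro card_mono) auto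
  also have "\<dots> \<le> card ((\<lambda>v. v \<otimes> inv u) ` S) + card ((\<lambda>v. u \<otimes> z \<otimes> inv v) ` S)"
    by (rule card_Un_le)
  also have "\<dots> \<le> card S + card S" using finite_S by (intro add_mono card_image_le)
  finally show ?thesis by simp
qed

text \<open>Equality in the count forces \<open>E\<close> to fill both covering sets, and the
  reflection takes \<open>v \<otimes> inv u\<close> to \<open>u \<otimes> z \<otimes> inv v\<close>
  and back.\<close>

lemma exceptions_reflection:
  assumes eq: "card E = 2 * card S" and z: "z \<in> E" "z \<notin> common_periods" and w: "w \<in> E"
  shows "z \<otimes> inv w \<in> E"
proof -
  obtain u where u: "u \<in> S"
    and sub: "E \<subseteq> (\<lambda>v. v \<otimes> inv u) ` S \<union> (\<lambda>v. u \<otimes> z \<otimes> inv v) ` S" (is "_ \<subseteq> ?V \<union> ?W")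
    using exceptions_two_translates z by blast
  have "card (?V \<union> ?W) \<le> card ?V + card ?W" by (rule card_Un_le)
  also have "\<dots> \<le> card S + card S" using finite_S by (intro add_mono card_image_le)
  finally have "card (?V \<union> ?W) \<le> card E" using eq by simp
  then have E: "E = ?V \<union> ?W" using sub finite_S by (intro card_seteq) auto
  have uc: "u \<in> carrier G" and zc: "z \<in> carrier G" using u S z E_carrier by auto
  have *: "z \<otimes> inv (v \<otimes> inv u) = u \<otimes> z \<otimes> inv v" "z \<otimes> inv (u \<otimes> z \<otimes> inv v) = v \<otimes> inv u"
    if v: "v \<in> S" for v
  proof -
    have vc: "v \<in> carrier G" using v S by auto
    show "z \<otimes> inv (v \<otimes> inv u) = u \<otimes> z \<otimes> inv v"
      using uc zc vc by (simp add: inv_mult m_ac)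
    have "v \<otimes> inv u \<otimes> (u \<otimes> z \<otimes> inv v) = (v \<otimes> inv v) \<otimes> (u \<otimes> inv u) \<otimes> z"
      using uc zc vc by (simp only: m_ac m_closed inv_closed)
    then have "v \<otimes> inv u \<otimes> (u \<otimes> z \<otimes> inv v) = z"
      using uc zc vc by simp
    then show "z \<otimes> inv (u \<otimes> z \<otimes> inv v) = v \<otimes> inv u"
      using uc zc vc by (simp add: inv_solve_right')
  qed
  then show ?thesis using w unfolding E by auto
qed

text \<open>For exceptions \<open>z\<close>, \<open>w\<close> that are not periods, reflecting each
  through the other puts \<open>w \<otimes> inv z\<close> and its inverse into \<open>E\<close>, so
  their quotient is a period. Thus \<open>E\<close> lies in two cosets of the group of periods, and
  2|S| elements fit there only if the periods fill \<open>S\<close>.\<close>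

lemma extremal_exceptions:
  assumes eq: "card E = 2 * card S"
  shows "common_periods = S" and "\<exists>z \<in> E. z \<notin> S"
proof -
  have "0 < card S" using finite_S one_S card_gt_0_iff by blast
  moreover have "card E \<le> card S" if "E \<subseteq> common_periods"
    using that common_periods_subset finite_S by (meson card_mono order_trans)
  ultimately obtain z where z: "z \<in> E" "z \<notin> common_periods" using eq by fastforce
  have zc: "z \<in> carrier G" using z E_carrier by auto
  have "w \<in> common_periods \<union> (\<lambda>p. p \<otimes> z) ` common_periods" if w: "w \<in> E" for w
  proof (cases "w \<in> common_periods")
    case False
    have wc: "w \<in> carrier G" using w E_carrier by auto
    have "inv (w \<otimes> inv z) = z \<otimes> inv w" using wc zc by (simp add: inv_mult m_comm)
    then have "w \<otimes> inv z \<in> common_periods"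
      using exceptions_reflection[OF eq z w] exceptions_reflection[OF eq w False z(1)]
      by (intro exception_inv_imp_period) auto
    moreover have "w = w \<otimes> inv z \<otimes> z" using wc zc by (simp add: m_assoc)
    ultimately show ?thesis by blast
  qed simp
  then have "card E \<le> card (common_periods \<union> (\<lambda>p. p \<otimes> z) ` common_periods)"
    using common_periods_subset finite_S finite_subset by (intro card_mono) auto
  also have "\<dots> \<le> card common_periods + card ((\<lambda>p. p \<otimes> z) ` common_periods)" by (rule card_Un_le)
  also have "\<dots> \<le> card common_periods + card common_periods"
    using common_periods_subset finite_S finite_subset by (intro add_mono card_image_le) auto
  finally have "card S \<le> card common_periods" using eq by simp
  then show "common_periods = S" using common_periods_subset finite_S card_seteq by metis
  then show "\<exists>z \<in> E. z \<notin> S" using z by blast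
qed

end

end

section \<open>The structure modulo \<open>\<Sigma>\<close>\<close>

text \<open>Conditions (ii) and (iii) of the theorem.\<close>

definition extremal_pair :: "('a, 'b) monoid_scheme \<Rightarrow> 'a set \<Rightarrow> 'a set \<Rightarrow> bool" where
  "extremal_pair Q A B \<longleftrightarrow> (\<exists>b \<in> A \<inter> B.
     let K = two_torsion Q;
         H = generate Q {b [^]\<^bsub>Q\<^esub> (2::nat)};
         d = card H;
         P = zero_and_odd_multiples Q b d
     in odd d \<and> d > 1 \<and>
        (\<exists>(m::nat) (k::nat) (l::nat) (x :: nat \<Rightarrow> 'a).
           real m = (real (order Q) / real d - real (L_group Q)) / 2 \<and>
           k \<le> l \<and> l \<le> m \<and>
           inj_on x {1..m} \<and>
           x ` {1..m} \<subseteq> carrier Q - (K <#>\<^bsub>Q\<^esub> H) \<and>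
           carrier Q - (K <#>\<^bsub>Q\<^esub> H) =
             (\<Union>i\<in>{1..m}. (x i <#\<^bsub>Q\<^esub> H) \<union> (inv\<^bsub>Q\<^esub> (x i) <#\<^bsub>Q\<^esub> H)) \<and>
           A = (P <#>\<^bsub>Q\<^esub> K) \<union>
             ((x ` {1..k} \<union> x ` {k+1..l} \<union> (\<lambda>i. inv\<^bsub>Q\<^esub> (x i)) ` {k+1..l}) <#>\<^bsub>Q\<^esub> H) \<and>
           B = (P <#>\<^bsub>Q\<^esub> K) \<union>
             ((x ` {1..k} \<union> x ` {l+1..m} \<union> (\<lambda>i. inv\<^bsub>Q\<^esub> (x i)) ` {l+1..m}) <#>\<^bsub>Q\<^esub> H)))"

text \<open>Concatenating duplicate-free lists of the three sets gives the numbering of condition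
  (iii), with the sets as consecutive blocks of indices.\<close>

lemma enumerate_three_sets:
  assumes "finite U" "finite V" "finite W" "U \<inter> V = {}" "U \<inter> W = {}" "V \<inter> W = {}"
  shows "\<exists>(m::nat) k l x. m = card (U \<union> V \<union> W) \<and> k \<le> l \<and> l \<le> m \<and> inj_on x {1..m} \<and>
    x ` {1..m} = U \<union> V \<union> W \<and> x ` {1..k} = U \<and> x ` {k+1..l} = V \<and> x ` {l+1..m} = W"
proof -
  obtain us vs ws where l: "set us = U" "distinct us" "set vs = V" "distinct vs"
    "set ws = W" "distinct ws"
    using assms finite_distinct_list by metis
  \<comment> \<open>List positions start at 0, the numbering at 1.\<close>
  define x where "x i = (us @ vs @ ws) ! (i - 1)" for i
  have im: "x ` {i+1..i + length ys} = set ys"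
    if "us @ vs @ ws = xs @ ys @ zs" "length xs = i" for i xs ys zs
  proof
    show "x ` {i+1..i + length ys} \<subseteq> set ys"
      unfolding x_def that(1) using that(2) by (auto simp: nth_append)
    show "set ys \<subseteq> x ` {i+1..i + length ys}"
    proof
      fix y assume "y \<in> set ys"
      then obtain j where "j < length ys" "ys ! j = y" by (auto simp: in_set_conv_nth)
      then have "y = x (i + 1 + j)" "i + 1 + j \<in> {i+1..i + length ys}"
        unfolding x_def that(1) using that(2) by (auto simp: nth_append)
      then show "y \<in> x ` {i+1..i + length ys}" by blast
    qed
  qed
  let ?k = "length us" and ?l = "length us + length vs" and ?m = "length (us @ vs @ ws)"
  have d: "distinct (us @ vs @ ws)" using l assms by auto
  have "inj_on x {1..?m}"
    using nth_eq_iff_index_eq[OF d] by (auto simp: inj_on_def x_def)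
  moreover have "x ` {1..?m} = U \<union> V \<union> W" using im[of "[]" "us @ vs @ ws" "[]" 0] l by auto
  moreover have "x ` {1..?k} = U" using im[of "[]" us "vs @ ws" 0] l by auto
  moreover have "x ` {?k+1..?l} = V" using im[of us vs ws ?k] l by auto
  moreover have "x ` {?l+1..?m} = W" using im[of "us @ vs" ws "[]" ?l] l by auto
  moreover have "?m = card (U \<union> V \<union> W)" using distinct_card[OF d] l by (simp add: Un_assoc)
  moreover have "?k \<le> ?l" "?l \<le> ?m" by simp_all
  ultimately show ?thesis by blast
qed

section \<open>The 2-torsion subgroup and cosets\<close>

context comm_group
begin

lemma subgroup_two_torsion: "subgroup (two_torsion G) G"
proof (rule subgroupI)
  show "two_torsion G \<noteq> {}" using two_torsion_iff[of \<one>] by auto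
next
  fix a b assume ab: "a \<in> two_torsion G" "b \<in> two_torsion G"
  then have "a \<in> carrier G" "b \<in> carrier G" by (simp_all add: two_torsion_iff)
  then have "a \<otimes> b \<otimes> (a \<otimes> b) = (a \<otimes> a) \<otimes> (b \<otimes> b)" by (simp only: m_ac m_closed)
  then show "a \<otimes> b \<in> two_torsion G" using ab by (simp add: two_torsion_iff)
qed (auto simp: two_torsion_iff simp flip: inv_mult)

lemma set_mult_iff: "y \<in> U <#> V \<longleftrightarrow> (\<exists>u \<in> U. \<exists>v \<in> V. y = u \<otimes> v)"
  by (auto simp: set_mult_def)

lemma lcoset_iff: "y \<in> a <# U \<longleftrightarrow> (\<exists>u \<in> U. y = a \<otimes> u)"
  by (auto simp: l_coset_def)

lemma card_lcoset:
  assumes "a \<in> carrier G" "U \<subseteq> carrier G"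
  shows "card (a <# U) = card U"
proof -
  have "a <# U = (\<lambda>u. a \<otimes> u) ` U" by (auto simp: l_coset_def)
  then show ?thesis using assms by (simp add: card_image inj_on_def subset_iff)
qed

text \<open>With \<open>S = {\<one>}\<close> the two exactness conditions say how membership in \<open>A\<close> changes along a step
  by \<open>z\<close>: it is lost when leaving the \<open>2\<close>-torsion and regained halfway round the coset of
  \<open>\<langle>z\<rangle>\<close>, and nothing happens on cosets that do not meet the \<open>2\<close>-torsion.\<close>

context
  fixes A B :: "'a set" and z :: 'a
  assumes fin: "finite (carrier G)"
    and A: "A \<subseteq> carrier G" and B: "B \<subseteq> carrier G" and z: "z \<in> carrier G" and z1: "z \<noteq> \<one>"
    and ex1: "exact_at G {\<one>} A B \<one>" and exz: "exact_at G {\<one>} A B z"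
begin

private abbreviation K :: "'a set" where "K \<equiv> two_torsion G"
private abbreviation H :: "'a set" where "H \<equiv> generate G {z}"
private abbreviation M :: "'a set" where "M \<equiv> K <#> H"

private lemma exact_pair_one:
  "y \<in> carrier G \<Longrightarrow> inv y \<in> B \<longleftrightarrow> y \<notin> A \<or> y \<otimes> y = \<one>" "y \<in> K \<Longrightarrow> y \<in> A"
  using ex1 by (auto simp: exact_at_def two_torsion_iff of_bool_def split: if_splits)

text \<open>The two identities at \<open>y\<close> share their left side, so \<open>B\<close>
  cancels: [\<open>y \<notin> A\<close>] + [\<open>y \<otimes> y = \<one>\<close>] =
  [\<open>y \<otimes> z \<notin> A\<close>] + [\<open>y \<otimes> y \<otimes> z = \<one>\<close>],
  where both sums are at most 1.\<close>

private lemma step_z: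
  assumes y: "y \<in> carrier G"
  shows "y \<otimes> z \<notin> A \<longleftrightarrow> (y \<notin> A \<or> y \<otimes> y = \<one>) \<and> y \<otimes> y \<otimes> z \<noteq> \<one>"
  using bspec[OF ex1[unfolded exact_at_def] y] bspec[OF exz[unfolded exact_at_def] y] y
  by (auto simp: of_bool_def split: if_splits)

private lemma square_K_pow:
  assumes k: "k \<in> K" and i: "y = k \<otimes> z [^] (i::nat)"
  shows "y \<in> carrier G" "y \<otimes> y = z [^] (2 * i)" "y \<otimes> y \<otimes> z = z [^] (2 * i + 1)"
    "y \<otimes> z = k \<otimes> z [^] Suc i"
proof -
  have kc: "k \<in> carrier G" "k \<otimes> k = \<one>" using k by (simp_all add: two_torsion_iff)
  show "y \<in> carrier G" using kc z i by simp
  have "y \<otimes> y = (k \<otimes> k) \<otimes> (z [^] i \<otimes> z [^] i)" unfolding i using kc(1) z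
    by (simp only: m_ac m_closed nat_pow_closed)
  then show 1: "y \<otimes> y = z [^] (2 * i)" using kc z by (simp add: nat_pow_mult mult_2)
  show "y \<otimes> y \<otimes> z = z [^] (2 * i + 1)" unfolding 1 by simp
  show "y \<otimes> z = k \<otimes> z [^] Suc i" using i kc z by (simp add: m_assoc)
qed

section \<open>The cosets of \<langle>z\<rangle> that meet the 2-torsion\<close>

private lemma ord_pos: "ord z > 0"
  using ord_ge_1[OF fin z] by simp

text \<open>If the order were even, \<open>z [^] (2 * i + 1)\<close> would never be
  \<open>\<one>\<close>, so membership in \<open>A\<close>, lost on leaving \<open>\<one>\<close>,
  could not be regained along the powers of \<open>z\<close>. These return to \<open>\<one>\<close>,
  which belongs to \<open>A\<close>.\<close>

private lemma odd_ord: "odd (ord z)"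
proof (rule ccontr)
  assume "\<not> odd (ord z)"
  then have n: "z [^] (2 * i + 1) \<noteq> \<one>" for i :: nat
    unfolding pow_eq_id[OF z] by (meson dvd_trans even_plus_one_iff dvd_triv_left even_mult_iff)
  have o: "\<one> \<in> K" using subgroup_two_torsion by (rule subgroup.one_closed)
  have "\<one> \<otimes> z [^] Suc i \<notin> A" for i
  proof (induction i)
    case 0
    show ?case using step_z[of \<one>] z z1 by simp
  next
    case (Suc i)
    note sq = square_K_pow[OF o refl, of "Suc i"]
    show ?case unfolding sq(4)[symmetric] step_z[OF sq(1)] sq(3) using Suc n by blast
  qed
  from this[of "ord z - 1"] have "\<one> \<notin> A" using ord_pos pow_ord_eq_1[OF z] by simp
  then show False using exact_pair_one(2)[OF o] by simp
qed

text \<open>The halfway index: among the elements \<open>k \<otimes> z [^] i\<close> with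
  \<open>k \<in> K\<close>, exponents from 1 to \<open>e\<close> fall outside \<open>A\<close> and
  those from \<open>e + 1\<close> to \<open>ord z\<close> inside.\<close>

private definition e :: nat where "e = (ord z - 1) div 2"

private lemma ord_e: "ord z = 2 * e + 1"
  using odd_ord by (auto simp: e_def elim!: oddE)

private lemma e_pos: "e \<ge> 1"
proof (rule ccontr)
  assume "\<not> ?thesis"
  then have "ord z = 1" using ord_e by simp
  then show False using z z1 ord_eq_1 by simp
qed

private lemma not_dvd:
  "0 < n \<Longrightarrow> n < ord z \<Longrightarrow> \<not> ord z dvd n"
  "ord z < n \<Longrightarrow> n < 2 * ord z \<Longrightarrow> \<not> ord z dvd n"
  by (simp_all add: nat_dvd_not_less) (auto elim!: dvdE)

text \<open>Membership is lost at the step out of \<open>k\<close>, whose square is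
  \<open>\<one>\<close>. It returns only when \<open>ord z\<close> divides \<open>2 * i + 1\<close>,
  which is too small for that as long as \<open>i < e\<close>.\<close>

private lemma low:
  assumes k: "k \<in> K" and i: "1 \<le> i" "i \<le> e"
  shows "k \<otimes> z [^] i \<notin> A"
  using i
proof (induction i rule: dec_induct)
  case base
  have "k \<in> carrier G" "k \<otimes> k = \<one>" using k by (simp_all add: two_torsion_iff)
  then show ?case using step_z[of k] z z1 by simp
next
  case (step i)
  note sq = square_K_pow[OF k refl, of i]
  have "\<not> ord z dvd 2 * i + 1" using step ord_e by (intro not_dvd(1)) auto
  then show ?case
    unfolding sq(4)[symmetric] step_z[OF sq(1)] sq(3) pow_eq_id[OF z] using step by auto
qed

text \<open>At exponent \<open>e\<close> the product \<open>y \<otimes> y \<otimes> z\<close> is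
  \<open>\<one>\<close>, which puts the next element into \<open>A\<close>. A later loss would need
  \<open>ord z\<close> to divide \<open>2 * i\<close>, a number strictly between
  \<open>ord z\<close> and \<open>2 * ord z\<close> until the exponent reaches
  \<open>ord z\<close>.\<close>

private lemma high:
  assumes k: "k \<in> K" and i: "e + 1 \<le> i" "i \<le> ord z"
  shows "k \<otimes> z [^] i \<in> A"
  using i
proof (induction i rule: dec_induct)
  case base
  note sq = square_K_pow[OF k refl, of e]
  have "z [^] (2 * e + 1) = \<one>" using ord_e pow_ord_eq_1[OF z] by simp
  then show ?case using sq(4) step_z[OF sq(1)] sq(3) by auto
next
  case (step i)
  note sq = square_K_pow[OF k refl, of i]
  have "\<not> ord z dvd 2 * i" using step ord_e by (intro not_dvd(2)) auto
  then have "\<not> (k \<otimes> z [^] i \<otimes> z \<notin> A)"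
    unfolding step_z[OF sq(1)] sq(2) pow_eq_id[OF z] using step by auto
  then show ?case unfolding sq(4)[symmetric] by simp
qed

private lemma H_eq: "H = {z [^] i | i::nat. True}"
  using generate_pow_on_finite_carrier[OF fin z] by auto

private lemma subgroup_H: "subgroup H G"
  using z by (intro generate_is_subgroup) auto

private lemma subgroup_M: "subgroup M G"
  by (rule mult_subgroups[OF subgroup_two_torsion subgroup_H])

private lemma mem_M_obtain:
  assumes "y \<in> M"
  obtains k i where "k \<in> K" "1 \<le> i" "i \<le> ord z" "y = k \<otimes> z [^] i"
proof -
  obtain k j where k: "k \<in> K" "y = k \<otimes> z [^] (j::nat)"
    using assms by (auto simp: set_mult_iff H_eq)
  \<comment> \<open>Exponents are reduced to the range from 1 to \<open>ord z\<close>, not from 0 to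
    \<open>ord z - 1\<close>, so that the members of \<open>A\<close> form one interval of
    exponents.\<close>
  define i where "i = (if ord z dvd j then ord z else j mod ord z)"
  have "z [^] i = z [^] j"
  proof (cases "ord z dvd j")
    case True
    then have "z [^] j = \<one>" using z pow_eq_id by blast
    then show ?thesis using True z by (simp add: i_def)
  next
    case False
    have "z [^] j = z [^] (ord z * (j div ord z)) \<otimes> z [^] (j mod ord z)"
      using z by (simp add: nat_pow_mult)
    also have "z [^] (ord z * (j div ord z)) = \<one>" using z by (simp add: pow_eq_id)
    finally show ?thesis using False z by (simp add: i_def)
  qed
  moreover have "1 \<le> i" "i \<le> ord z"
    using ord_pos by (auto simp: i_def dvd_eq_mod_eq_0 Suc_leI intro: less_imp_le)
  ultimately show thesis using that k by simp
qed

private lemma K_pow_mem_M: "k \<in> K \<Longrightarrow> k \<otimes> z [^] (i::nat) \<in> M"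
  by (auto simp: set_mult_iff H_eq)

private lemma mem_A_M:
  assumes k: "k \<in> K" and i: "1 \<le> i" "i \<le> ord z"
  shows "k \<otimes> z [^] i \<in> A \<longleftrightarrow> e + 1 \<le> i"
  using low[OF k i(1)] high[OF k _ i(2)] by fastforce

text \<open>The inverse of \<open>k \<otimes> z [^] i\<close> is
  \<open>k \<otimes> z [^] (ord z - i)\<close>. This reflection of exponents exchanges the two
  halves, and the complement in the identity at \<open>\<one>\<close> exchanges them back; for
  \<open>i = ord z\<close> the square is \<open>\<one>\<close> and the element lies in both
  sets.\<close>

private lemma mem_B_M:
  assumes k: "k \<in> K" and i: "1 \<le> i" "i \<le> ord z"
  shows "k \<otimes> z [^] i \<in> B \<longleftrightarrow> e + 1 \<le> i"
proof -
  let ?y = "k \<otimes> z [^] (ord z - i)"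
  note sq = square_K_pow[OF k refl, of "ord z - i"]
  have kc: "k \<in> carrier G" "k \<otimes> k = \<one>" using k by (simp_all add: two_torsion_iff)
  have "(k \<otimes> z [^] i) \<otimes> ?y = (k \<otimes> k) \<otimes> (z [^] i \<otimes> z [^] (ord z - i))"
    using kc(1) z by (simp only: m_ac m_closed nat_pow_closed)
  also have "\<dots> = \<one>" using kc z i by (simp add: nat_pow_mult)
  finally have "inv ?y = k \<otimes> z [^] i" using kc z by (intro inv_equality) auto
  then have *: "k \<otimes> z [^] i \<in> B \<longleftrightarrow> ?y \<notin> A \<or> ord z dvd 2 * (ord z - i)"
    using exact_pair_one(1)[OF sq(1)] sq(2) pow_eq_id[OF z] by simp
  show ?thesis
  proof (cases "i = ord z")
    case True
    then show ?thesis unfolding * using ord_e by simp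
  next
    case False
    have "\<not> ord z dvd ord z - i" using False i by (intro not_dvd(1)) auto
    moreover have "coprime (ord z) 2" using odd_ord by simp
    ultimately have "\<not> ord z dvd 2 * (ord z - i)" using coprime_dvd_mult_right_iff by blast
    then show ?thesis
      unfolding * using mem_A_M[OF k, of "ord z - i"] False i ord_e by auto
  qed
qed

text \<open>The square root of \<open>z\<close> in \<langle>z\<rangle>, since
  \<open>2 * (e + 1) = ord z + 1\<close>; it serves as the element \<open>b\<close> of condition
  (ii).\<close>

private definition b :: 'a where "b = z [^] (e + 1)"

private lemma b_square: "b \<otimes> b = z" "b [^] (2::nat) = z" "b \<in> carrier G"
proof -
  have "b \<otimes> b = z [^] (ord z) \<otimes> z"
    unfolding b_def nat_pow_mult[OF z] nat_pow_Suc[symmetric] ord_e by (simp only: mult_2) simp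
  then show "b \<otimes> b = z" using z by simp
  then show "b [^] (2::nat) = z" using z by (simp add: numeral_2_eq_2 b_def)
  show "b \<in> carrier G" using z by (simp add: b_def)
qed

private lemma b_odd_pow: "b [^] (2 * j + 1) = z [^] (e + 1 + j)"
proof -
  have "b [^] (2 * j + 1) = (b [^] (2::nat)) [^] j \<otimes> b"
    using b_square(3) by (simp add: nat_pow_pow)
  also have "\<dots> = z [^] j \<otimes> z [^] (e + 1)" unfolding b_square(2) by (simp add: b_def)
  also have "\<dots> = z [^] (j + (e + 1))" by (rule nat_pow_mult[OF z])
  finally show ?thesis by (simp only: add.commute)
qed

text \<open>The odd multiple with factor \<open>2 * j + 1\<close> is the power of \<open>z\<close>
  with exponent \<open>e + 1 + j\<close>, and the bound \<open>ord z - 2\<close> on the factor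
  becomes \<open>ord z - 1\<close> on the exponent. The remaining exponent \<open>ord z\<close>
  belongs to \<open>\<one>\<close>.\<close>

private lemma P_eq:
  "zero_and_odd_multiples G b (ord z) = {z [^] i | i. e + 1 \<le> i \<and> i \<le> ord z}"
proof (intro equalityI subsetI)
  fix y assume "y \<in> zero_and_odd_multiples G b (ord z)"
  then consider "y = \<one>" | j :: nat where "y = b [^] j" "odd j" "1 \<le> j" "j \<le> ord z - 2"
    by (auto simp: zero_and_odd_multiples_def)
  then show "y \<in> {z [^] i | i. e + 1 \<le> i \<and> i \<le> ord z}"
  proof cases
    case 1
    then have "y = z [^] ord z" using z by simp
    moreover have "e + 1 \<le> ord z" using ord_e by simp
    ultimately show ?thesis by blast
  next
    case 2
    then obtain i where "j = 2 * i + 1" by (auto elim: oddE)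
    then have "y = z [^] (e + 1 + i)" "e + 1 + i \<le> ord z"
      using 2 b_odd_pow ord_e by auto
    then show ?thesis by (metis (mono_tags, lifting) le_add1 mem_Collect_eq)
  qed
next
  fix y assume "y \<in> {z [^] i | i. e + 1 \<le> i \<and> i \<le> ord z}"
  then obtain i where i: "y = z [^] i" "e + 1 \<le> i" "i \<le> ord z" by blast
  show "y \<in> zero_and_odd_multiples G b (ord z)"
  proof (cases "i = ord z")
    case True
    then show ?thesis using i z by (simp add: zero_and_odd_multiples_def)
  next
    case False
    then have "y = b [^] (2 * (i - (e + 1)) + 1)" unfolding b_odd_pow using i by simp
    moreover have "2 * (i - (e + 1)) + 1 \<le> ord z - 2" using False i ord_e by auto
    moreover have "odd (2 * (i - (e + 1)) + 1)" "1 \<le> 2 * (i - (e + 1)) + 1" by simp_all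
    ultimately show ?thesis unfolding zero_and_odd_multiples_def by blast
  qed
qed

private abbreviation P :: "'a set" where "P \<equiv> zero_and_odd_multiples G b (ord z)"

private lemma mem_PK: "y \<in> P <#> K \<longleftrightarrow> (\<exists>k \<in> K. \<exists>i. e + 1 \<le> i \<and> i \<le> ord z \<and> y = k \<otimes> z [^] i)"
proof -
  have "z [^] i \<otimes> k = k \<otimes> z [^] i" if "k \<in> K" for i :: nat and k
    using that z by (simp add: m_comm two_torsion_iff)
  then have "y = z [^] i \<otimes> k \<longleftrightarrow> y = k \<otimes> z [^] i" if "k \<in> K" for i :: nat and k
    using that by simp
  then show ?thesis unfolding set_mult_iff P_eq by blast
qed

private lemma inter_M: "A \<inter> M = P <#> K" "B \<inter> M = P <#> K"
proof -
  have "(y \<in> A \<and> y \<in> M \<longleftrightarrow> y \<in> P <#> K) \<and> (y \<in> B \<and> y \<in> M \<longleftrightarrow> y \<in> P <#> K)" for y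
  proof (cases "y \<in> M")
    case True
    then obtain k i where ki: "k \<in> K" "1 \<le> i" "i \<le> ord z" "y = k \<otimes> z [^] i"
      by (rule mem_M_obtain)
    have "y \<in> A \<longleftrightarrow> y \<in> P <#> K"
    proof
      assume "y \<in> A"
      then show "y \<in> P <#> K" using ki mem_A_M[OF ki(1-3)] unfolding mem_PK by blast
    next
      assume "y \<in> P <#> K"
      then show "y \<in> A" unfolding mem_PK using high by blast
    qed
    then show ?thesis using True mem_A_M[OF ki(1-3)] mem_B_M[OF ki(1-3)] ki(4) by simp
  next
    case False
    then show ?thesis unfolding mem_PK using K_pow_mem_M by blast
  qed
  then show "A \<inter> M = P <#> K" "B \<inter> M = P <#> K" by blast+
qed

section \<open>The cosets of \<langle>z\<rangle> that avoid the 2-torsion\<close>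

private lemma square_in_H_imp_M:
  assumes y: "y \<in> carrier G" and "y \<otimes> y \<in> H"
  shows "y \<in> M"
proof -
  obtain i :: nat where i: "y \<otimes> y = z [^] i" using assms(2) by (auto simp: H_eq)
  \<comment> \<open>This is \<open>b [^] i\<close>, a square root of \<open>z [^] i\<close> inside
    \<open>H\<close>; dividing \<open>y\<close> by it leaves a 2-torsion element.\<close>
  let ?c = "z [^] ((e + 1) * i)"
  have c: "?c \<in> carrier G" using z by simp
  have "?c \<otimes> ?c = z [^] i"
  proof -
    have "?c = b [^] i" unfolding b_def by (rule nat_pow_pow[OF z, symmetric])
    then have "?c \<otimes> ?c = (b \<otimes> b) [^] i" using b_square(3) by (simp add: nat_pow_distrib)
    then show ?thesis using b_square by simp
  qed
  moreover have "(y \<otimes> inv ?c) \<otimes> (y \<otimes> inv ?c) = (y \<otimes> y) \<otimes> inv (?c \<otimes> ?c)"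
    using y c by (simp only: inv_mult m_ac m_closed inv_closed)
  ultimately have "(y \<otimes> inv ?c) \<otimes> (y \<otimes> inv ?c) = z [^] i \<otimes> inv (z [^] i)" by (simp only: i)
  then have "y \<otimes> inv ?c \<in> K" using y c z by (simp add: two_torsion_iff)
  then have "(y \<otimes> inv ?c) \<otimes> ?c \<in> M" by (rule K_pow_mem_M)
  then show ?thesis using y c by simp
qed

private lemma one_H: "\<one> \<in> H"
  using subgroup_H by (rule subgroup.one_closed)

private lemma z_H: "z \<in> H"
  by (rule generate.incl) simp

private lemma H_sub: "H \<subseteq> carrier G"
  using subgroup_H by (rule subgroup.subset)

text \<open>Outside \<open>M\<close> no square lies in \<open>H\<close>, so neither special case of
  \<open>step_z\<close> occurs and membership in \<open>A\<close> is constant along the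
  coset.\<close>

private lemma off_M_mult:
  assumes y: "y \<in> carrier G" "y \<notin> M" and h: "h \<in> H"
  shows "y \<otimes> h \<notin> M" and "y \<otimes> h \<in> A \<longleftrightarrow> y \<in> A"
proof -
  have notM: "y \<otimes> h \<notin> M" if h: "h \<in> H" for h
  proof
    assume "y \<otimes> h \<in> M"
    moreover have hM: "h \<in> M"
      using h H_sub subgroup.one_closed[OF subgroup_two_torsion] unfolding set_mult_iff by force
    then have "inv h \<in> M" using subgroup_M by (simp add: subgroup.m_inv_closed)
    ultimately have "y \<otimes> h \<otimes> inv h \<in> M" using subgroup_M by (simp add: subgroup.m_closed)
    then show False using y h H_sub by auto
  qed
  then show "y \<otimes> h \<notin> M" using h .
  obtain i :: nat where i: "h = z [^] i" using h by (auto simp: H_eq)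
  have "y \<otimes> z [^] i \<in> A \<longleftrightarrow> y \<in> A"
  proof (induction i)
    case (Suc i)
    let ?y = "y \<otimes> z [^] i"
    have yc: "?y \<in> carrier G" using y z by simp
    have n: "?y \<notin> M" using notM H_eq by auto
    then have "?y \<otimes> ?y \<notin> H" using square_in_H_imp_M[OF yc] by blast
    moreover have "?y \<otimes> ?y = inv z" if "?y \<otimes> ?y \<otimes> z = \<one>"
      using inv_equality[OF that z] yc by simp
    ultimately have "?y \<otimes> ?y \<noteq> \<one>" "?y \<otimes> ?y \<otimes> z \<noteq> \<one>"
      using one_H subgroup.m_inv_closed[OF subgroup_H z_H] by metis+
    then have "?y \<otimes> z \<in> A \<longleftrightarrow> ?y \<in> A" using step_z[OF yc] by blast
    then show ?case using Suc y z by (simp add: m_assoc)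
  qed (use y in simp)
  then show "y \<otimes> h \<in> A \<longleftrightarrow> y \<in> A" using i by simp
qed

text \<open>Outside \<open>M\<close> squares differ from \<open>\<one>\<close>, and the identity at
  \<open>\<one>\<close> reduces to complementation.\<close>

private lemma off_M_inv:
  assumes y: "y \<in> carrier G" "y \<notin> M"
  shows "inv y \<notin> M" and "y \<in> B \<longleftrightarrow> inv y \<notin> A"
proof -
  show n: "inv y \<notin> M" using y subgroup.m_inv_closed[OF subgroup_M, of "inv y"] by auto
  have "inv y \<otimes> inv y \<noteq> \<one>" using square_in_H_imp_M[of "inv y"] n one_H y by auto
  then show "y \<in> B \<longleftrightarrow> inv y \<notin> A" using exact_pair_one(1)[of "inv y"] y by simp
qed

text \<open>The blocks of the decomposition in condition (iii). Those outside \<open>M\<close> all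
  have size \<open>2 * ord z\<close>, which yields the value of \<open>m\<close>.\<close>

private definition cl :: "'a \<Rightarrow> 'a set" where "cl y = (y <# H) \<union> (inv y <# H)"

private lemma cl_self: "y \<in> carrier G \<Longrightarrow> y \<in> cl y" "y \<in> carrier G \<Longrightarrow> inv y \<in> cl y"
  using bexI[OF _ one_H, where P = "\<lambda>u. y = y \<otimes> u"]
    bexI[OF _ one_H, where P = "\<lambda>u. inv y = inv y \<otimes> u"]
  by (simp_all add: cl_def lcoset_iff)

private lemma cl_off_M:
  assumes "y \<in> carrier G - M"
  shows "cl y \<subseteq> carrier G - M"
  using assms off_M_mult(1) off_M_inv(1) subsetD[OF H_sub] by (auto simp: cl_def lcoset_iff)

private lemma cl_eq:
  assumes y: "y \<in> carrier G" and u: "u \<in> cl y"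
  shows "cl u = cl y"
proof -
  have *: "inv u <# H = inv y <# H" "u <# H = y <# H" if u: "u \<in> y <# H" and y: "y \<in> carrier G" for u y
  proof -
    obtain h where h: "h \<in> H" "u = y \<otimes> h" using u by (auto simp: lcoset_iff)
    then have "inv u = inv y \<otimes> inv h" "inv h \<in> H"
      using y H_sub subgroup.m_inv_closed[OF subgroup_H] by (auto simp: inv_mult)
    then have "inv u \<in> inv y <# H" by (auto simp: lcoset_iff)
    then show "inv u <# H = inv y <# H" using l_repr_independence subgroup_H y by simp
    show "u <# H = y <# H" using l_repr_independence subgroup_H y u by simp
  qed
  from u consider "u \<in> y <# H" | "u \<in> inv y <# H" by (auto simp: cl_def)
  then show ?thesis
  proof cases
    case 1
    then show ?thesis using *[OF 1 y] by (simp add: cl_def)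
  next
    case 2
    then show ?thesis using *[OF 2] y by (auto simp add: cl_def)
  qed
qed

private lemma card_H: "card H = ord z"
  using generate_pow_card[OF z] by simp

text \<open>A common element of \<open>y <# H\<close> and \<open>inv y <# H\<close> would give
  \<open>y \<otimes> y \<in> H\<close> and hence \<open>y \<in> M\<close>, so the two cosets are
  disjoint.\<close>

private lemma card_cl:
  assumes y: "y \<in> carrier G - M"
  shows "card (cl y) = 2 * ord z"
proof -
  have "(y <# H) \<inter> (inv y <# H) = {}"
  proof (rule ccontr)
    assume "\<not> ?thesis"
    then obtain h g where hg: "h \<in> H" "g \<in> H" "y \<otimes> h = inv y \<otimes> g" by (auto simp: lcoset_iff)
    then have c: "h \<in> carrier G" "g \<in> carrier G" using H_sub by auto
    have "y \<otimes> y = y \<otimes> (y \<otimes> h) \<otimes> inv h" using y c by (simp add: m_assoc)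
    also have "\<dots> = g \<otimes> inv h" unfolding hg(3) using y c by simp
    finally have "y \<otimes> y \<in> H"
      using hg subgroup_H by (simp add: subgroup.m_closed subgroup.m_inv_closed)
    then show False using square_in_H_imp_M y by blast
  qed
  moreover have "finite (a <# H)" if "a \<in> carrier G" for a
    using that H_sub fin by (metis finite_subset l_coset_subset_G)
  ultimately show ?thesis
    using y H_sub by (simp add: cl_def card_Un_disjoint card_lcoset card_H)
qed

text \<open>\<open>K\<close> and \<open>H\<close> meet trivially because \<open>H\<close> has odd
  order, so each element of \<open>M\<close> is a product in only one way.\<close>

private lemma card_M: "card M = L_group G * ord z"
proof -
  have Kc: "K \<subseteq> carrier G" by (auto simp: two_torsion_iff)
  have "inj_on (\<lambda>(k, h). k \<otimes> h) (K \<times> H)"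
  proof (rule inj_onI, clarsimp)
    fix k h k' h'
    assume a: "k \<in> K" "h \<in> H" "k' \<in> K" "h' \<in> H" and eq: "k \<otimes> h = k' \<otimes> h'"
    have c: "k \<in> carrier G" "k' \<in> carrier G" "h \<in> carrier G" "h' \<in> carrier G"
      using a Kc H_sub by auto
    have "inv k' \<otimes> k = inv k' \<otimes> (k \<otimes> h) \<otimes> inv h" using c by (simp add: m_assoc)
    also have "\<dots> = h' \<otimes> inv h" unfolding eq using c by simp
    finally have 1: "inv k' \<otimes> k = h' \<otimes> inv h" .
    have "h' \<otimes> inv h \<in> H"
      using a subgroup_H by (simp add: subgroup.m_closed subgroup.m_inv_closed)
    then obtain i :: nat where i: "h' \<otimes> inv h = z [^] i" by (auto simp: H_eq)
    have "inv k' \<otimes> k \<in> K"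
      using a subgroup_two_torsion by (simp add: subgroup.m_closed subgroup.m_inv_closed)
    then have "z [^] i \<otimes> z [^] i = \<one>" using 1 i by (simp add: two_torsion_iff)
    then have "ord z dvd i + i" using z by (simp add: nat_pow_mult pow_eq_id)
    then have "ord z dvd 2 * i" by (simp add: mult_2)
    moreover have "coprime (ord z) 2" using odd_ord by simp
    ultimately have "ord z dvd i" using coprime_dvd_mult_right_iff by blast
    then have 2: "h' \<otimes> inv h = \<one>" using i z by (simp add: pow_eq_id)
    have "h' = h' \<otimes> inv h \<otimes> h" using c by simp
    then have "h = h'" unfolding 2 using c by simp
    then show "k = k' \<and> h = h'" using eq c by simp
  qed
  moreover have "M = (\<lambda>(k, h). k \<otimes> h) ` (K \<times> H)" by (auto simp: set_mult_def)
  ultimately show ?thesis by (simp add: card_image L_group_def card_H card_cartesian_product)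
qed

text \<open>One representative is taken from each block outside \<open>M\<close>, and the
  representatives are sorted by whether they and their inverses lie in \<open>A\<close>; this yields
  the three ranges of indices. Inside \<open>M\<close>, \<open>inter_M\<close> describes both
  sets.\<close>

lemma exact_pair_extremal: "extremal_pair G A B"
proof -
  let ?R = "carrier G - M"
  \<comment> \<open>A representative in \<open>A\<close> is preferred, so that one outside
    \<open>A\<close> has its whole block outside \<open>A\<close>; this excludes
    \<open>w \<notin> A\<close> with \<open>inv w \<in> A\<close>.\<close>
  define r where "r C = (if C \<inter> A \<noteq> {} then SOME x. x \<in> C \<inter> A else SOME x. x \<in> C)" for C
  have r: "r (cl y) \<in> cl y" "r (cl y) \<in> A \<longleftrightarrow> cl y \<inter> A \<noteq> {}" if "y \<in> ?R" for y
  proof -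
    have *: "cl y \<inter> A \<noteq> {} \<Longrightarrow> (SOME x. x \<in> cl y \<inter> A) \<in> cl y \<inter> A"
      using some_in_eq[of "cl y \<inter> A"] by simp
    have **: "(SOME x. x \<in> cl y) \<in> cl y" using some_in_eq[of "cl y"] cl_self(1)[of y] that by auto
    show "r (cl y) \<in> cl y" "r (cl y) \<in> A \<longleftrightarrow> cl y \<inter> A \<noteq> {}"
      using * ** by (auto simp: r_def)
  qed
  define W where "W = r ` cl ` ?R"
  have W: "W \<subseteq> ?R" using r(1) cl_off_M by (auto simp: W_def)
  have W_cl: "\<exists>w \<in> W. cl w = cl y" if y: "y \<in> ?R" for y
  proof
    show "r (cl y) \<in> W" using y by (auto simp: W_def)
    show "cl (r (cl y)) = cl y" using cl_eq[of y] r(1)[OF y] y by blast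
  qed
  have W_rep: "w = r (cl w)" if w: "w \<in> W" for w
  proof -
    obtain y where y: "y \<in> ?R" "w = r (cl y)" using w by (auto simp: W_def)
    then show ?thesis using cl_eq[of y w] r(1)[OF y(1)] by simp
  qed
  have cover: "?R = (\<Union>w\<in>W. cl w)"
  proof
    show "?R \<subseteq> (\<Union>w\<in>W. cl w)" using W_cl cl_self(1) by blast
    show "(\<Union>w\<in>W. cl w) \<subseteq> ?R" using W cl_off_M by blast
  qed
  have disj: "cl w \<inter> cl w' = {}" if "w \<in> W" "w' \<in> W" "w \<noteq> w'" for w w'
  proof (rule ccontr)
    assume "cl w \<inter> cl w' \<noteq> {}"
    then obtain u where "u \<in> cl w" "u \<in> cl w'" by blast
    then have "cl w = cl w'" using cl_eq that W by (metis DiffD1 subsetD)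
    then show False using W_rep that by metis
  qed
  have finW: "finite W" using W fin finite_subset by blast
  have finR: "finite ?R" using fin by simp
  have "finite (cl w)" if "w \<in> W" for w
    using finite_subset[OF _ finR] cl_off_M that W by blast
  then have "card ?R = (\<Sum>w\<in>W. card (cl w))"
    unfolding cover using finW disj by (intro card_UN_disjoint) auto
  also have "\<dots> = card W * (2 * ord z)" using W card_cl by (simp add: subset_iff)
  finally have cR: "card ?R = card W * (2 * ord z)" .
  have Mc: "M \<subseteq> carrier G" using subgroup_M by (rule subgroup.subset)
  have "card ?R = order G - card M"
    using Mc fin by (metis card_Diff_subset finite_subset order_def)
  moreover have "card M \<le> order G" using Mc fin by (simp add: card_mono order_def)
  ultimately have "order G = card W * (2 * ord z) + L_group G * ord z"
    using cR card_M by simp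
  then have "real (order G) = real (card W) * (2 * real (ord z)) + real (L_group G) * real (ord z)"
    by (metis of_nat_add of_nat_mult of_nat_numeral)
  then have count: "real (card W) = (real (order G) / real (ord z) - real (L_group G)) / 2"
    using ord_pos by (simp add: field_simps)
  \<comment> \<open>By \<open>off_M_inv\<close>, elements of \<open>U\<close> lie in both
    \<open>A\<close> and \<open>B\<close> and their inverses in neither; for \<open>V\<close> the
    element and its inverse lie in \<open>A\<close> only, for \<open>T\<close> in \<open>B\<close>
    only.\<close>
  define U V T where "U = {w \<in> W. w \<in> A \<and> inv w \<notin> A}" and "V = {w \<in> W. w \<in> A \<and> inv w \<in> A}"
    and "T = {w \<in> W. w \<notin> A}"
  have UVT: "U \<union> V \<union> T = W" by (auto simp: U_def V_def T_def)
  have dis: "U \<inter> V = {}" "U \<inter> T = {}" "V \<inter> T = {}" by (auto simp: U_def V_def T_def)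
  have fins: "finite U" "finite V" "finite T" using finW by (auto simp: U_def V_def T_def)
  obtain m k l x where x: "m = card W" "k \<le> l" "l \<le> m" "inj_on x {1..m}" "x ` {1..m} = W"
    "x ` {1..k} = U" "x ` {k+1..l} = V" "x ` {l+1..m} = T"
    using enumerate_three_sets[OF fins dis] unfolding UVT by blast
  have im: "(\<lambda>i. inv (x i)) ` I = (\<lambda>w. inv w) ` x ` I" for I by (simp add: image_image)
  have T_inv: "inv w \<notin> A" if "w \<in> T" for w
  proof -
    have "w \<in> W" "w \<notin> A" using that by (auto simp: T_def)
    then have "cl w \<inter> A = {}" using r(2)[of w] W W_rep by auto
    then show ?thesis using cl_self(2)[of w] \<open>w \<in> W\<close> W by blast
  qed
  have cosets: "(Y <#> H) \<inter> M = {} \<and> Y <#> H \<subseteq> carrier G" if "Y \<subseteq> ?R" for Y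
  proof -
    have "y \<otimes> h \<in> ?R" if "y \<in> Y" "h \<in> H" for y h
      using off_M_mult(1)[of y h] that \<open>Y \<subseteq> ?R\<close> H_sub by (meson DiffD1 DiffD2 DiffI m_closed subsetD)
    then show ?thesis unfolding set_mult_def by blast
  qed
  have invR: "inv w \<in> ?R" if "w \<in> ?R" for w using that off_M_inv(1) by auto
  have rep: "\<exists>w \<in> W. \<exists>h \<in> H. y = w \<otimes> h \<or> y = inv w \<otimes> h" if "y \<in> ?R" for y
    using that unfolding cover by (auto simp: cl_def lcoset_iff)
  have A_off: "y \<in> A \<longleftrightarrow> y \<in> (U \<union> V \<union> (\<lambda>w. inv w) ` V) <#> H" if y: "y \<in> ?R" for y
  proof
    assume yA: "y \<in> A"
    obtain w h where w: "w \<in> W" "h \<in> H" "y = w \<otimes> h \<or> y = inv w \<otimes> h" using rep[OF y] by blast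
    have wR: "w \<in> ?R" "inv w \<in> ?R" using w W invR by auto
    show "y \<in> (U \<union> V \<union> (\<lambda>w. inv w) ` V) <#> H"
    proof (cases "y = w \<otimes> h")
      case True
      then have "w \<in> A" using off_M_mult(2)[of w h] w wR yA by auto
      then have "w \<in> U \<union> V" using w by (auto simp: U_def V_def)
      then show ?thesis using True w by (auto simp: set_mult_iff)
    next
      case False
      then have yi: "y = inv w \<otimes> h" using w by simp
      then have "inv w \<in> A" using off_M_mult(2)[of "inv w" h] w wR yA by auto
      then have "w \<in> V" using w T_inv[of w] by (auto simp: V_def T_def)
      then show ?thesis using yi w by (auto simp: set_mult_iff)
    qed
  next
    assume "y \<in> (U \<union> V \<union> (\<lambda>w. inv w) ` V) <#> H"
    then obtain v h where v: "v \<in> U \<union> V \<union> (\<lambda>w. inv w) ` V" "h \<in> H" "y = v \<otimes> h"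
      by (auto simp: set_mult_iff)
    have "v \<in> A" "v \<in> ?R" using v W invR by (auto simp: U_def V_def)
    then show "y \<in> A" using off_M_mult(2)[of v h] v by auto
  qed
  have B_off: "y \<in> B \<longleftrightarrow> y \<in> (U \<union> T \<union> (\<lambda>w. inv w) ` T) <#> H" if y: "y \<in> ?R" for y
  proof -
    have B_H: "v \<otimes> h \<in> B \<longleftrightarrow> inv v \<notin> A" if v: "v \<in> ?R" and h: "h \<in> H" for v h
    proof -
      have hc: "h \<in> carrier G" using h H_sub by auto
      have ih: "inv h \<in> H" using h subgroup.m_inv_closed[OF subgroup_H] by blast
      have "v \<otimes> h \<in> B \<longleftrightarrow> inv (v \<otimes> h) \<notin> A"
        using off_M_inv(2)[of "v \<otimes> h"] off_M_mult(1)[of v h] v h hc by auto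
      also have "\<dots> \<longleftrightarrow> inv v \<otimes> inv h \<notin> A" using v hc by (simp add: inv_mult)
      also have "\<dots> \<longleftrightarrow> inv v \<notin> A" using off_M_mult(2)[of "inv v" "inv h"] invR[OF v] ih by auto
      finally show ?thesis .
    qed
    show ?thesis
    proof
      assume yB: "y \<in> B"
      obtain w h where w: "w \<in> W" "h \<in> H" "y = w \<otimes> h \<or> y = inv w \<otimes> h" using rep[OF y] by blast
      have wR: "w \<in> ?R" "inv w \<in> ?R" using w W invR by auto
      show "y \<in> (U \<union> T \<union> (\<lambda>w. inv w) ` T) <#> H"
      proof (cases "y = w \<otimes> h")
        case True
        then have "inv w \<notin> A" using B_H[OF wR(1) w(2)] yB by auto
        then have "w \<in> U \<union> T" using w by (auto simp: U_def T_def)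
        then show ?thesis using True w by (auto simp: set_mult_iff)
      next
        case False
        then have yi: "y = inv w \<otimes> h" using w by simp
        then have "w \<notin> A" using B_H[OF wR(2) w(2)] yB wR by auto
        then have "w \<in> T" using w by (auto simp: T_def)
        then show ?thesis using yi w by (auto simp: set_mult_iff)
      qed
    next
      assume "y \<in> (U \<union> T \<union> (\<lambda>w. inv w) ` T) <#> H"
      then obtain v h where v: "v \<in> U \<union> T \<union> (\<lambda>w. inv w) ` T" "h \<in> H" "y = v \<otimes> h"
        by (auto simp: set_mult_iff)
      have vR: "v \<in> ?R" using v(1) W invR by (auto simp: U_def T_def)
      have "inv w \<in> ?R \<and> w \<in> carrier G" if "w \<in> T" for w using that W invR by (auto simp: T_def)
      then have "inv v \<notin> A" using v(1) T_inv by (auto simp: U_def T_def)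
      then show "y \<in> B" using B_H[OF vR v(2)] v(3) by simp
    qed
  qed
  have subR: "U \<union> V \<union> (\<lambda>w. inv w) ` V \<subseteq> ?R" "U \<union> T \<union> (\<lambda>w. inv w) ` T \<subseteq> ?R"
    using W invR by (auto simp: U_def V_def T_def)
  have A_eq: "A = (P <#> K) \<union> ((U \<union> V \<union> (\<lambda>w. inv w) ` V) <#> H)"
    (is "A = ?A1 \<union> ?A2")
  proof (rule Set.set_eqI)
    fix y
    show "y \<in> A \<longleftrightarrow> y \<in> ?A1 \<union> ?A2"
    proof (cases "y \<in> M")
      case True
      then show ?thesis using inter_M(1) cosets[OF subR(1)] by blast
    next
      case False
      then have "y \<notin> ?A1" using inter_M(1) by blast
      then show ?thesis using False A_off[of y] cosets[OF subR(1)] A by blast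
    qed
  qed
  have B_eq: "B = (P <#> K) \<union> ((U \<union> T \<union> (\<lambda>w. inv w) ` T) <#> H)"
    (is "B = ?B1 \<union> ?B2")
  proof (rule Set.set_eqI)
    fix y
    show "y \<in> B \<longleftrightarrow> y \<in> ?B1 \<union> ?B2"
    proof (cases "y \<in> M")
      case True
      then show ?thesis using inter_M(2) cosets[OF subR(2)] by blast
    next
      case False
      then have "y \<notin> ?B1" using inter_M(2) by blast
      then show ?thesis using False B_off[of y] cosets[OF subR(2)] B by blast
    qed
  qed
  have o: "\<one> \<in> K" using subgroup_two_torsion by (rule subgroup.one_closed)
  have "\<one> \<otimes> z [^] (e + 1) \<in> A" "\<one> \<otimes> z [^] (e + 1) \<in> B"
    using mem_A_M[OF o, of "e + 1"] mem_B_M[OF o, of "e + 1"] ord_e by auto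
  then have bAB: "b \<in> A \<inter> B" using z by (simp add: b_def del: nat_pow_Suc)
  have x2: "?R = (\<Union>i\<in>{1..m}. (x i <# H) \<union> (inv (x i) <# H))"
    using cover unfolding x(5)[symmetric] cl_def by simp
  have d1: "ord z > 1" using ord_e e_pos by simp
  show ?thesis
    unfolding extremal_pair_def Let_def
  proof (rule bexI[OF _ bAB], unfold b_square(2) card_H, rule conjI[OF odd_ord],
      rule conjI[OF d1], rule exI[of _ m], rule exI[of _ k], rule exI[of _ l], rule exI[of _ x],
      intro conjI)
    show "A = (P <#> K) \<union> ((x ` {1..k} \<union> x ` {k + 1..l} \<union> (\<lambda>i. inv x i) ` {k + 1..l}) <#> H)"
      unfolding im x(6,7) by (rule A_eq)
    show "B = (P <#> K) \<union> ((x ` {1..k} \<union> x ` {l + 1..m} \<union> (\<lambda>i. inv x i) ` {l + 1..m}) <#> H)"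
      unfolding im x(6,8) by (rule B_eq)
    show "x ` {1..m} \<subseteq> carrier G - M" unfolding x(5) by (rule W)
    show "real m = (real (order G) / real (ord z) - real (L_group G)) / 2"
      unfolding x(1) by (rule count)
  qed (fact x x2)+
qed

end

end

section \<open>From an extremal pair back to exceptions\<close>

context comm_group
begin

text \<open>The witness is the square of \<open>b\<close>. Inside the subgroup generated by
  2-torsion and \<open>H\<close>, comparing exponents forces equal factors. Outside it, shifting a
  factor by an element of \<open>H\<close> would turn a representation of \<open>z\<close> into one
  of \<open>\<one>\<close>, which the hypothesis confines to the 2-torsion.\<close>

lemma extremal_pair_doubles:
  assumes fin: "finite (carrier G)" and A: "A \<subseteq> carrier G" and B: "B \<subseteq> carrier G"
    and one: "\<And>a c. a \<in> A \<Longrightarrow> c \<in> B \<Longrightarrow> a \<otimes> c = \<one> \<Longrightarrow> a \<otimes> a = \<one>"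
    and ext: "extremal_pair G A B"
  shows "\<exists>z \<in> carrier G. z \<noteq> \<one> \<and> (\<forall>a \<in> A. \<forall>c \<in> B. a \<otimes> c = z \<longrightarrow> a = c)"
proof -
  let ?K = "two_torsion G"
  obtain b where b: "b \<in> A" "b \<in> B" and body: "let H = generate G {b [^] (2::nat)};
         d = card H; P = zero_and_odd_multiples G b d
     in odd d \<and> d > 1 \<and>
        (\<exists>(m::nat) (k::nat) (l::nat) (x :: nat \<Rightarrow> 'a).
           real m = (real (order G) / real d - real (L_group G)) / 2 \<and>
           k \<le> l \<and> l \<le> m \<and>
           inj_on x {1..m} \<and>
           x ` {1..m} \<subseteq> carrier G - (?K <#> H) \<and>
           carrier G - (?K <#> H) =
             (\<Union>i\<in>{1..m}. (x i <# H) \<union> (inv (x i) <# H)) \<and>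
           A = (P <#> ?K) \<union>
             ((x ` {1..k} \<union> x ` {k+1..l} \<union> (\<lambda>i. inv (x i)) ` {k+1..l}) <#> H) \<and>
           B = (P <#> ?K) \<union>
             ((x ` {1..k} \<union> x ` {l+1..m} \<union> (\<lambda>i. inv (x i)) ` {l+1..m}) <#> H))"
    using ext unfolding extremal_pair_def Let_def by blast
  define z where "z = b [^] (2::nat)"
  define H where "H = generate G {z}"
  define d where "d = card H"
  define P where "P = zero_and_odd_multiples G b d"
  let ?M = "?K <#> H"
  have bc: "b \<in> carrier G" using b A by auto
  have z: "z \<in> carrier G" using bc by (simp add: z_def)
  have bb: "b \<otimes> b = z" using bc by (simp add: z_def numeral_2_eq_2)
  have dz: "d = ord z" using generate_pow_card[OF z] by (simp add: d_def H_def)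
  obtain m k l :: nat and x :: "nat \<Rightarrow> 'a" where od: "odd d" "d > 1"
    and kl: "k \<le> l" "l \<le> m" and xR: "x ` {1..m} \<subseteq> carrier G - ?M"
    and A_eq: "A = (P <#> ?K) \<union>
      ((x ` {1..k} \<union> x ` {k+1..l} \<union> (\<lambda>i. inv (x i)) ` {k+1..l}) <#> H)"
    and B_eq: "B = (P <#> ?K) \<union>
      ((x ` {1..k} \<union> x ` {l+1..m} \<union> (\<lambda>i. inv (x i)) ` {l+1..m}) <#> H)"
    using body[unfolded Let_def, folded z_def, folded H_def, folded d_def, folded P_def] by blast
  have sH: "subgroup H G" unfolding H_def using z by (intro generate_is_subgroup) auto
  have sM: "subgroup ?M G" by (rule mult_subgroups[OF subgroup_two_torsion sH])
  have HM: "H \<subseteq> ?M"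
    using subgroup.one_closed[OF subgroup_two_torsion] subgroup.subset[OF sH]
    by (force simp: set_mult_iff)
  have KM: "?K \<subseteq> ?M"
    using subgroup.one_closed[OF sH] by (force simp: set_mult_iff two_torsion_iff)
  have zH: "z \<in> H" unfolding H_def by (rule generate.incl) simp
  have invR: "inv u \<in> carrier G - ?M" if "u \<in> carrier G - ?M" for u
    using that subgroup.m_inv_closed[OF sM, of "inv u"] by auto
  define U where "U = x ` {1..k} \<union> x ` {k+1..l} \<union> (\<lambda>i. inv (x i)) ` {k+1..l}"
  define V where "V = x ` {1..k} \<union> x ` {l+1..m} \<union> (\<lambda>i. inv (x i)) ` {l+1..m}"
  have xi: "x i \<in> carrier G - ?M" if "1 \<le> i" "i \<le> m" for i using xR that by (simp add: image_subset_iff)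
  have UR: "U \<subseteq> carrier G - ?M" unfolding U_def using xi invR[OF xi] kl by auto
  have VR: "V \<subseteq> carrier G - ?M" unfolding V_def using xi invR[OF xi] kl by auto
  have bpow: "(b [^] i \<otimes> k) \<otimes> (b [^] i \<otimes> k) = z [^] i" if "k \<in> ?K" for i :: nat and k
  proof -
    have kc: "k \<in> carrier G" "k \<otimes> k = \<one>" using that by (simp_all add: two_torsion_iff)
    have "(b [^] i \<otimes> k) \<otimes> (b [^] i \<otimes> k) = (b [^] i \<otimes> b [^] i) \<otimes> (k \<otimes> k)"
      using kc(1) bc by (simp only: m_ac m_closed nat_pow_closed)
    also have "\<dots> = (b \<otimes> b) [^] i" using kc bc by (simp add: nat_pow_distrib)
    finally show ?thesis by (simp add: bb)
  qed
  have off: "a \<notin> ?M" if aW: "a \<in> W <#> H" and WR: "W \<subseteq> carrier G - ?M" for a W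
  proof
    assume aM: "a \<in> ?M"
    obtain w h where w: "w \<in> W" "h \<in> H" "a = w \<otimes> h" using aW by (auto simp: set_mult_iff)
    have c: "w \<in> carrier G" "h \<in> carrier G" using w WR subgroup.subset[OF sH] by auto
    have "a \<otimes> inv h \<in> ?M"
      using aM w HM sM by (meson subgroup.m_closed subgroup.m_inv_closed subsetD)
    then show False using w c WR by auto
  qed
  have stable: "a \<otimes> h \<in> W <#> H"
    if aW: "a \<in> W <#> H" and h: "h \<in> H" and WR: "W \<subseteq> carrier G - ?M" for a h W
  proof -
    obtain w g where w: "w \<in> W" "g \<in> H" "a = w \<otimes> g" using aW by (auto simp: set_mult_iff)
    have c: "w \<in> carrier G" "h \<in> carrier G" "g \<in> carrier G"
      using w h WR subgroup.subset[OF sH] by auto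
    then have "a \<otimes> h = w \<otimes> (g \<otimes> h)" using w by (simp add: m_assoc)
    moreover have "g \<otimes> h \<in> H" using subgroup.m_closed[OF sH] w h by blast
    ultimately show ?thesis using w by (auto simp: set_mult_iff)
  qed
  text \<open>Comparing squares gives \<open>i + j \<equiv> 2\<close> modulo \<open>d\<close> for the two exponents; their size and parity
    leave only \<open>i = j = 1\<close>.\<close>
  have inP: "a = c" if ac: "a \<in> P <#> ?K" "c \<in> P <#> ?K" "a \<otimes> c = z" for a c
  proof -
    have ob: "\<exists>i k. k \<in> ?K \<and> a = b [^] i \<otimes> k \<and> (i = 0 \<or> odd i \<and> i \<le> d - 2)"
      if aP: "a \<in> P <#> ?K" for a
    proof -
      obtain p k where pk: "p \<in> P" "k \<in> ?K" "a = p \<otimes> k" using aP by (auto simp: set_mult_iff)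
      have "\<exists>i::nat. p = b [^] i \<and> (i = 0 \<or> odd i \<and> i \<le> d - 2)"
      proof -
        consider "p = b [^] (0::nat)" | j :: nat where "p = b [^] j" "odd j" "j \<le> d - 2"
          using pk(1) by (auto simp: P_def zero_and_odd_multiples_def)
        then show ?thesis by cases blast+
      qed
      then show ?thesis using pk by blast
    qed
    obtain i k where i: "k \<in> ?K" "a = b [^] i \<otimes> k" "i = 0 \<or> odd i \<and> i \<le> d - 2"
      using ob[OF ac(1)] by blast
    obtain j k' where j: "k' \<in> ?K" "c = b [^] j \<otimes> k'" "j = 0 \<or> odd j \<and> j \<le> d - 2"
      using ob[OF ac(2)] by blast
    have kc: "k \<in> carrier G" "k' \<in> carrier G" "k \<otimes> k = \<one>"
      using i j by (simp_all add: two_torsion_iff)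
    have acc: "a \<in> carrier G" "c \<in> carrier G" using i j kc bc by auto
    have "z \<otimes> z = (a \<otimes> a) \<otimes> (c \<otimes> c)"
      unfolding ac(3)[symmetric] using acc by (simp only: m_ac m_closed)
    also have "\<dots> = z [^] (i + j)"
      using bpow[OF i(1), of i] bpow[OF j(1), of j] i(2) j(2) z by (simp add: nat_pow_mult)
    \<comment> \<open>Multiplying by \<open>z [^] (d - 2)\<close> turns \<open>z \<otimes> z\<close>
      into \<open>z [^] d = \<one>\<close> while all exponents stay natural numbers.\<close>
    finally have "z \<otimes> z \<otimes> z [^] (d - 2) = z [^] (i + j) \<otimes> z [^] (d - 2)" by simp
    moreover have "z \<otimes> z = z [^] (2::nat)" using z by (simp add: numeral_2_eq_2)
    ultimately have "z [^] (i + j + (d - 2)) = z [^] (2 + (d - 2))"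
      using z by (simp only: nat_pow_mult)
    also have "2 + (d - 2) = d" using od by simp
    finally have "z [^] (i + j + (d - 2)) = \<one>" using z dz by simp
    then have "d dvd i + j + (d - 2)" using z dz pow_eq_id by blast
    then obtain q where q: "i + j + (d - 2) = d * q" by (auto elim: dvdE)
    have d3: "d \<ge> 3" using od by (cases "d = 2") auto
    have "i \<le> d - 2" "j \<le> d - 2" using i(3) j(3) by auto
    then have "d * q < d * 3" using q d3 by linarith
    then have "q < 3" by simp
    moreover have "q \<noteq> 0" using q d3 by (intro notI) simp
    ultimately consider "q = 1" | "q = 2" by linarith
    then have "i = 1 \<and> j = 1"
    proof cases
      case 1
      then have "i + j = 2" using q d3 by simp
      then show ?thesis using i(3) j(3) by (cases "i = 0"; cases "j = 0") (auto elim!: oddE)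
    next
      case 2
      then have s: "i + j = d + 2" using q d3 by simp
      then have "odd (i + j)" using od by simp
      then have "i = 0 \<or> j = 0" using i(3) j(3) by auto
      then show ?thesis using s \<open>i \<le> d - 2\<close> \<open>j \<le> d - 2\<close> d3 by auto
    qed
    then have ij: "a = b \<otimes> k" "c = b \<otimes> k'" using i j bc by simp_all
    have "z \<otimes> (k \<otimes> k') = (b \<otimes> b) \<otimes> (k \<otimes> k')" by (simp only: bb)
    also have "\<dots> = a \<otimes> c" unfolding ij using bc kc(1,2) by (simp only: m_ac m_closed)
    finally have "z \<otimes> (k \<otimes> k') = z" using ac(3) by simp
    then have "k \<otimes> k' = k \<otimes> k" using z kc by (simp add: kc(3))
    then have "k' = k" using kc(1,2) by simp
    then show "a = c" using ij by simp
  qed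
  have PM: "P <#> ?K \<subseteq> ?M"
  proof
    fix a assume "a \<in> P <#> ?K"
    then obtain p k where pk: "p \<in> P" "k \<in> ?K" "a = p \<otimes> k" by (auto simp: set_mult_iff)
    \<comment> \<open>\<open>b [^] d\<close> is in \<open>?K\<close> because its square is
      \<open>z [^] d = \<one>\<close>, and \<open>b [^] (d - 1)\<close> is a power of
      \<open>z\<close> because \<open>d\<close> is odd; \<open>b\<close> is their quotient.\<close>
    have "b \<in> ?M"
    proof -
      obtain f where f: "d = 2 * f + 1" using od by (auto elim: oddE)
      have c: "b [^] d \<in> ?K"
      proof -
        have "b [^] d \<otimes> b [^] d = z [^] d"
          using bpow[of \<one> d] bc subgroup.one_closed[OF subgroup_two_torsion] by simp
        then show ?thesis using bc z dz by (simp add: two_torsion_iff)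
      qed
      have "z [^] f \<in> H" 
        by (induction f) (use zH sH in \<open>auto simp: subgroup.one_closed subgroup.m_closed\<close>)
      then have iH: "inv (z [^] f) \<in> H" using sH by (simp add: subgroup.m_inv_closed)
      have "z [^] f = b [^] (2 * f)" unfolding z_def using bc by (simp add: nat_pow_pow)
      then have "b = b [^] d \<otimes> inv (z [^] f)" using bc f by simp
      then show ?thesis using c iH by (auto simp: set_mult_iff)
    qed
    then have "b [^] i \<in> ?M" for i :: nat
      by (induction i) (use sM in \<open>auto simp: subgroup.one_closed subgroup.m_closed\<close>)
    then have "p \<in> ?M" using pk(1) subgroup.one_closed[OF sM]
      by (auto simp: P_def zero_and_odd_multiples_def)
    then show "a \<in> ?M" using pk KM sM by (auto simp: subgroup.m_closed)
  qed
  have "a = c" if ac: "a \<in> A" "c \<in> B" "a \<otimes> c = z" for a c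
  proof -
    have c: "a \<in> carrier G" "c \<in> carrier G" using ac A B by auto
    have zM: "z \<in> ?M" using zH HM by blast
    have cz: "c \<otimes> inv z = inv a"
      unfolding ac(3)[symmetric] using c by (simp add: inv_mult m_assoc[symmetric])
    \<comment> \<open>If \<open>a\<close> is outside \<open>?M\<close>, so is \<open>c\<close>, and
      the part of \<open>B\<close> outside \<open>?M\<close> is a union of cosets of
      \<open>H\<close>. Hence \<open>inv a = c \<otimes> inv z\<close> lies in \<open>B\<close>, and
      \<open>a \<otimes> inv a = \<one>\<close> makes \<open>a\<close> a 2-torsion element of
      \<open>?M\<close> after all.\<close>
    have aM: "a \<in> ?M"
    proof (rule ccontr)
      assume n: "a \<notin> ?M"
      have "a = z \<otimes> inv c" unfolding ac(3)[symmetric] using c by simp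
      then have "c \<notin> ?M" using n zM sM subgroup.m_closed subgroup.m_inv_closed by metis
      then have "c \<in> V <#> H" using ac(2) B_eq PM unfolding V_def by blast
      then have "inv a \<in> V <#> H"
        using stable[OF _ subgroup.m_inv_closed[OF sH zH] VR] cz by metis
      then have "inv a \<in> B" using B_eq unfolding V_def by blast
      then have "a \<otimes> a = \<one>" using one[OF ac(1)] c by simp
      then show False using n KM c by (auto simp: two_torsion_iff)
    qed
    have "c = inv a \<otimes> z" unfolding ac(3)[symmetric] using c by simp
    then have cM: "c \<in> ?M" using aM zM sM subgroup.m_closed subgroup.m_inv_closed by metis
    have "a \<in> P <#> ?K" using ac(1) A_eq off[OF _ UR] aM unfolding U_def by blast
    moreover have "c \<in> P <#> ?K" using ac(2) B_eq off[OF _ VR] cM unfolding V_def by blast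
    ultimately show ?thesis using inP ac(3) by blast
  qed
  moreover have "z \<noteq> \<one>" using od dz z ord_eq_1 by auto
  ultimately show ?thesis using z by blast
qed

section \<open>Exactness under translation and projection\<close>

lemma mem_rcoset_inv:
  assumes "U \<subseteq> carrier G" "g \<in> carrier G" "y \<in> carrier G"
  shows "y \<in> U #> inv g \<longleftrightarrow> y \<otimes> g \<in> U"
proof
  assume "y \<in> U #> inv g"
  then obtain u where "u \<in> U" "y = u \<otimes> inv g" by (auto simp: r_coset_def)
  then show "y \<otimes> g \<in> U" using assms by (auto simp: subset_iff)
next
  assume "y \<otimes> g \<in> U"
  moreover have "y = (y \<otimes> g) \<otimes> inv g" using assms by simp
  ultimately show "y \<in> U #> inv g" unfolding r_coset_def by blast
qed

lemma rcoset_eq_iff: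
  assumes "subgroup N G" "x \<in> carrier G" "y \<in> carrier G"
  shows "N #> x = N #> y \<longleftrightarrow> x \<otimes> inv y \<in> N"
proof
  assume "N #> x = N #> y"
  then have "x \<in> N #> y" using rcos_self assms by metis
  then show "x \<otimes> inv y \<in> N" using assms by (auto simp: r_coset_def subgroup.mem_carrier)
next
  assume "x \<otimes> inv y \<in> N"
  then have "x \<in> N #> y"
    using assms by (auto simp: r_coset_def intro!: bexI[of _ "x \<otimes> inv y"])
  then show "N #> x = N #> y" using repr_independence assms by metis
qed

text \<open>Substituting \<open>y \<otimes> inv g\<close> for \<open>y\<close>, which still runs
  over the whole group, turns each of the three memberships into its translated form.\<close>

lemma exact_at_translate:
  assumes c: "A \<subseteq> carrier G" "B \<subseteq> carrier G" "S \<subseteq> carrier G"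
    "s \<in> carrier G" "g \<in> carrier G" "w \<in> carrier G"
  shows "exact_at G (S #> inv s) (A #> inv (g \<otimes> s)) (B #> inv g) w \<longleftrightarrow>
    exact_at G S A B (w \<otimes> (g \<otimes> g \<otimes> s))"
proof -
  have 1: "inv y \<in> B #> inv g \<longleftrightarrow> inv (y \<otimes> inv g) \<in> B"
    and 2: "y \<otimes> w \<in> A #> inv (g \<otimes> s) \<longleftrightarrow> y \<otimes> inv g \<otimes> (w \<otimes> (g \<otimes> g \<otimes> s)) \<in> A"
    and 3: "y \<otimes> y \<otimes> w \<in> S #> inv s \<longleftrightarrow>
      y \<otimes> inv g \<otimes> (y \<otimes> inv g) \<otimes> (w \<otimes> (g \<otimes> g \<otimes> s)) \<in> S" if y: "y \<in> carrier G" for y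
  proof -
    show "inv y \<in> B #> inv g \<longleftrightarrow> inv (y \<otimes> inv g) \<in> B"
      using mem_rcoset_inv[OF c(2,5), of "inv y"] y c by (simp add: inv_mult)
    have "y \<otimes> inv g \<otimes> (w \<otimes> (g \<otimes> g \<otimes> s)) = (inv g \<otimes> g) \<otimes> (y \<otimes> w \<otimes> (g \<otimes> s))"
      using y c(4-) by (simp only: m_ac m_closed inv_closed)
    then have "y \<otimes> inv g \<otimes> (w \<otimes> (g \<otimes> g \<otimes> s)) = y \<otimes> w \<otimes> (g \<otimes> s)" using y c by simp
    then show "y \<otimes> w \<in> A #> inv (g \<otimes> s) \<longleftrightarrow> y \<otimes> inv g \<otimes> (w \<otimes> (g \<otimes> g \<otimes> s)) \<in> A"
      using mem_rcoset_inv[OF c(1), of "g \<otimes> s" "y \<otimes> w"] y c by simp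
    have "y \<otimes> inv g \<otimes> (y \<otimes> inv g) \<otimes> (w \<otimes> (g \<otimes> g \<otimes> s))
        = (inv g \<otimes> g) \<otimes> (inv g \<otimes> g) \<otimes> (y \<otimes> y \<otimes> w \<otimes> s)"
      using y c(4-) by (simp only: m_ac m_closed inv_closed)
    then have "y \<otimes> inv g \<otimes> (y \<otimes> inv g) \<otimes> (w \<otimes> (g \<otimes> g \<otimes> s)) = y \<otimes> y \<otimes> w \<otimes> s"
      using y c by simp
    then show "y \<otimes> y \<otimes> w \<in> S #> inv s \<longleftrightarrow>
        y \<otimes> inv g \<otimes> (y \<otimes> inv g) \<otimes> (w \<otimes> (g \<otimes> g \<otimes> s)) \<in> S"
      using mem_rcoset_inv[OF c(3,4), of "y \<otimes> y \<otimes> w"] y c by simp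
  qed
  let ?F = "\<lambda>y. (of_bool (inv y \<in> B) :: int) = of_bool (y \<otimes> (w \<otimes> (g \<otimes> g \<otimes> s)) \<notin> A) +
    of_bool (y \<otimes> y \<otimes> (w \<otimes> (g \<otimes> g \<otimes> s)) \<in> S)"
  have "exact_at G (S #> inv s) (A #> inv (g \<otimes> s)) (B #> inv g) w \<longleftrightarrow>
      (\<forall>y \<in> carrier G. ?F (y \<otimes> inv g))"
    unfolding exact_at_def using 1 2 3 by simp
  also have "\<dots> \<longleftrightarrow> (\<forall>y \<in> carrier G. ?F y)"
  proof (intro iffI ballI)
    fix y assume a: "\<forall>y \<in> carrier G. ?F (y \<otimes> inv g)" and y: "y \<in> carrier G"
    have "y \<otimes> g \<otimes> inv g = y" using y c by simp
    then show "?F y" using bspec[OF a, of "y \<otimes> g"] y c by simp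
  next
    fix y assume a: "\<forall>y \<in> carrier G. ?F y" and y: "y \<in> carrier G"
    show "?F (y \<otimes> inv g)" by (rule bspec[OF a]) (use y c in simp)
  qed
  finally show ?thesis unfolding exact_at_def .
qed

lemma FactGroup_rcoset:
  assumes N: "subgroup N G" and x: "x \<in> carrier G" and y: "y \<in> carrier G"
  shows "(N #> x) \<otimes>\<^bsub>G Mod N\<^esub> (N #> y) = N #> (x \<otimes> y)"
    and "inv\<^bsub>G Mod N\<^esub> (N #> x) = N #> inv x"
    and "N #> x \<in> carrier (G Mod N)"
proof -
  interpret normal N G using N by (simp add: normal_iff_subgroup)
  show "(N #> x) \<otimes>\<^bsub>G Mod N\<^esub> (N #> y) = N #> (x \<otimes> y)" using x y by (simp add: rcos_sum)
  show c: "N #> x \<in> carrier (G Mod N)" using x by (auto simp: carrier_FactGroup)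
  show "inv\<^bsub>G Mod N\<^esub> (N #> x) = N #> inv x" using inv_FactGroup[OF c] rcos_inv[OF x] by simp
qed

text \<open>As \<open>A\<close> and \<open>B\<close> are unions of cosets of \<open>N\<close>, every
  term of the identity depends only on the coset of \<open>y\<close>, and membership in
  \<open>N\<close> becomes equality with the unit.\<close>

lemma exact_at_FactGroup:
  assumes N: "subgroup N G" and w: "w \<in> carrier G"
    and sA: "\<And>x. x \<in> carrier G \<Longrightarrow> N #> x \<in> A' \<longleftrightarrow> x \<in> A"
    and sB: "\<And>x. x \<in> carrier G \<Longrightarrow> N #> x \<in> B' \<longleftrightarrow> x \<in> B"
  shows "exact_at (G Mod N) {\<one>\<^bsub>G Mod N\<^esub>} A' B' (N #> w) \<longleftrightarrow> exact_at G N A B w"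
proof -
  have one: "N #> y = N \<longleftrightarrow> y \<in> N" if "y \<in> carrier G" for y
    using rcoset_eq_iff[OF N that one_closed] that subgroup.subset[OF N] by simp
  show ?thesis
    unfolding exact_at_def carrier_FactGroup ball_simps using w
    by (intro ball_cong refl) (simp add: FactGroup_rcoset[OF N] sA sB one del: mult_FactGroup)
qed

end

section \<open>Translation and passage to the quotient\<close>

context comm_group
begin

text \<open>With \<open>U\<close> the preimage of a projected set, this rewrites condition (iv) as:
  the translated set is a union of full cosets.\<close>

lemma lcoset_preimage_iff:
  assumes A: "A \<subseteq> carrier G" and g: "g \<in> carrier G" and U: "U \<subseteq> carrier G"
    and A0: "\<And>y. y \<in> carrier G \<Longrightarrow> y \<in> A0 \<longleftrightarrow> y \<otimes> g \<in> A"
  shows "A = g <# U \<longleftrightarrow> (\<forall>y \<in> carrier G. y \<in> U \<longleftrightarrow> y \<in> A0)"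
proof -
  have "y \<in> g <# U \<longleftrightarrow> inv g \<otimes> y \<in> U" if "y \<in> carrier G" for y
    unfolding lcoset_iff using that g U by (metis mult_inv_cancel(1,2) subsetD)
  moreover have "g <# U \<subseteq> carrier G" using g U by (simp add: l_coset_subset_G)
  ultimately have "A = g <# U \<longleftrightarrow> (\<forall>y \<in> carrier G. y \<in> A \<longleftrightarrow> inv g \<otimes> y \<in> U)"
    using A by blast
  also have "\<dots> \<longleftrightarrow> (\<forall>y \<in> carrier G. y \<otimes> g \<in> A \<longleftrightarrow> y \<in> U)"
  proof (rule iffI; rule ballI)
    fix y assume a: "\<forall>y \<in> carrier G. y \<in> A \<longleftrightarrow> inv g \<otimes> y \<in> U" and y: "y \<in> carrier G"
    have "inv g \<otimes> (y \<otimes> g) = y" using y g by (simp add: m_comm[of y g])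
    then show "y \<otimes> g \<in> A \<longleftrightarrow> y \<in> U" using bspec[OF a, of "y \<otimes> g"] y g by simp
  next
    fix y assume a: "\<forall>y \<in> carrier G. y \<otimes> g \<in> A \<longleftrightarrow> y \<in> U" and y: "y \<in> carrier G"
    have "inv g \<otimes> y \<otimes> g = y" using y g by (simp add: m_comm[of "inv g" y])
    then show "y \<in> A \<longleftrightarrow> inv g \<otimes> y \<in> U" using bspec[OF a, of "inv g \<otimes> y"] y g by simp
  qed
  finally show ?thesis using A0 by auto
qed

end

theorem theorem18:
  fixes G (structure) and A B S :: "'a set" and s b\<^sub>s :: 'a
  assumes "comm_group G" and "finite (carrier G)"
    and "A \<subseteq> carrier G" and "B \<subseteq> carrier G" and "S \<subseteq> carrier G"
    and "A \<noteq> {}" and "B \<noteq> {}" and "S \<noteq> {}"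
    and "card A + card B = order G + L_max G S"
    and "L_max G S = card S * L_group G"
    and "s \<in> S" and "b\<^sub>s \<in> (A #> inv s) \<inter> B"
    and "b\<^sub>s [^] (2::nat) \<otimes> s \<in> exceptions G S A B"
  shows "int (card (restricted_sumset G S A B)) = int (order G) - 2 * int (card S) \<longleftrightarrow>
    (let \<Sigma> = S #> inv s;
         Q = G Mod \<Sigma>;
         \<pi> = (\<lambda>g. \<Sigma> #> g);
         A' = \<pi> ` (A #> inv (b\<^sub>s \<otimes> s));
         B' = \<pi> ` (B #> inv b\<^sub>s);
         K = two_torsion Q
     in subgroup \<Sigma> G \<and>
        (\<exists>b \<in> A' \<inter> B'.
           let H = generate Q {b [^]\<^bsub>Q\<^esub> (2::nat)};
               d = card H;
               P = zero_and_odd_multiples Q b d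
           in odd d \<and> d > 1 \<and>
              (\<exists>(m::nat) (k::nat) (l::nat) (x :: nat \<Rightarrow> 'a set).
                 real m = (real (order Q) / real d - real (L_group Q)) / 2 \<and>
                 k \<le> l \<and> l \<le> m \<and>
                 inj_on x {1..m} \<and>
                 x ` {1..m} \<subseteq> carrier Q - (K <#>\<^bsub>Q\<^esub> H) \<and>
                 carrier Q - (K <#>\<^bsub>Q\<^esub> H) =
                   (\<Union>i\<in>{1..m}. (x i <#\<^bsub>Q\<^esub> H) \<union> (inv\<^bsub>Q\<^esub> (x i) <#\<^bsub>Q\<^esub> H)) \<and>
                 A' = (P <#>\<^bsub>Q\<^esub> K) \<union>
                   ((x ` {1..k} \<union> x ` {k+1..l} \<union> (\<lambda>i. inv\<^bsub>Q\<^esub> (x i)) ` {k+1..l}) <#>\<^bsub>Q\<^esub> H) \<and>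
                 B' = (P <#>\<^bsub>Q\<^esub> K) \<union>
                   ((x ` {1..k} \<union> x ` {l+1..m} \<union> (\<lambda>i. inv\<^bsub>Q\<^esub> (x i)) ` {l+1..m}) <#>\<^bsub>Q\<^esub> H))) \<and>
        A = (b\<^sub>s \<otimes> s) <# {g \<in> carrier G. \<pi> g \<in> A'} \<and>
        B = b\<^sub>s <# {g \<in> carrier G. \<pi> g \<in> B'})"
proof -
  interpret comm_group G by fact
  note fin = assms(2) and A = assms(3) and B = assms(4) and S = assms(5)
  define N where "N = S #> inv s"
  define A0 where "A0 = A #> inv (b\<^sub>s \<otimes> s)"
  define B0 where "B0 = B #> inv b\<^sub>s"
  \<comment> \<open>The given exception, which the translation moves to
    \<open>\<one>\<close>.\<close>
  define z0 where "z0 = b\<^sub>s \<otimes> b\<^sub>s \<otimes> s"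
  define E where "E = exceptions G S A B"
  define E0 where "E0 = {w \<in> carrier G. exact_at G N A0 B0 w}"
  define A' where "A' = (\<lambda>g. N #> g) ` A0"
  define B' where "B' = (\<lambda>g. N #> g) ` B0"
  have s: "s \<in> carrier G" and g: "b\<^sub>s \<in> carrier G" using assms by auto
  have z0: "z0 \<in> carrier G" using s g by (simp add: z0_def)
  have z0E: "z0 \<in> E" using assms(13) s g by (simp add: z0_def E_def numeral_2_eq_2)
  have cards: "card A + card B = order G + card S * L_group G" using assms(9,10) by simp
  note exc = fin A B S assms(8) cards
  have AB: "A <#> B = carrier G" by (rule set_mult_eq_carrier[OF exc])
  have E_iff: "z \<in> E \<longleftrightarrow> exact_at G S A B z" if "z \<in> carrier G" for z
    using exceptionD(1)[OF exc] exact_at_imp_exception[OF exc that] unfolding E_def by blast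
  have E_sub: "E \<subseteq> carrier G" by (auto simp: E_def exceptions_def AB)
  \<comment> \<open>The exceptions are the complement of the restricted sumset, so the claimed size
    means that they number 2|S|.\<close>
  have lhs: "int (card (restricted_sumset G S A B)) = int (order G) - 2 * int (card S) \<longleftrightarrow>
      card E = 2 * card S"
    using card_restricted_sumset[OF exc] unfolding E_def by linarith
  have N_iff: "y \<in> N \<longleftrightarrow> y \<otimes> s \<in> S" if "y \<in> carrier G" for y
    unfolding N_def by (rule mem_rcoset_inv[OF S s that])
  have A0_iff: "y \<in> A0 \<longleftrightarrow> y \<otimes> (b\<^sub>s \<otimes> s) \<in> A" if "y \<in> carrier G" for y
    unfolding A0_def by (rule mem_rcoset_inv[OF A _ that]) (use s g in simp)
  have B0_iff: "y \<in> B0 \<longleftrightarrow> y \<otimes> b\<^sub>s \<in> B" if "y \<in> carrier G" for y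
    unfolding B0_def by (rule mem_rcoset_inv[OF B g that])
  have Nc: "N \<subseteq> carrier G" and A0c: "A0 \<subseteq> carrier G" and B0c: "B0 \<subseteq> carrier G"
    unfolding N_def A0_def B0_def using A B S s g by (simp_all add: r_coset_subset_G)
  have E0_iff: "w \<in> E0 \<longleftrightarrow> w \<otimes> z0 \<in> E" if w: "w \<in> carrier G" for w
    using exact_at_translate[OF A B S s g w] E_iff[of "w \<otimes> z0"] w z0
    by (simp add: E0_def N_def A0_def B0_def z0_def)
  have E0_eq: "E0 = {w \<in> carrier G. w \<otimes> z0 \<in> E}" using E0_iff by (auto simp: E0_def)
  have cardE: "card E0 = card E" unfolding E0_eq by (rule card_translate_preimage[OF E_sub z0])
  have "N = {w \<in> carrier G. w \<otimes> s \<in> S}" using N_iff Nc by auto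
  then have cardN: "card N = card S" using card_translate_preimage[OF S s] by simp
  have oneN: "\<one> \<in> N" using N_iff[of \<one>] s assms(11) by simp
  have oneE: "\<one> \<in> E0" using E0_iff[of \<one>] z0 z0E by simp
  have square: "\<exists>y \<in> carrier G. y \<otimes> y \<otimes> z = t" if z: "z \<in> E0" and t: "t \<in> N" for z t
  proof -
    have c: "z \<in> carrier G" "t \<in> carrier G" using z t Nc by (auto simp: E0_def)
    obtain y where y: "y \<in> carrier G" "y \<otimes> y \<otimes> (z \<otimes> z0) = t \<otimes> s"
      using exceptionD(2)[OF exc, of "z \<otimes> z0"] E0_iff[OF c(1)] N_iff[OF c(2)] z t
      unfolding E_def by blast
    have "((y \<otimes> b\<^sub>s) \<otimes> (y \<otimes> b\<^sub>s) \<otimes> z) \<otimes> s = y \<otimes> y \<otimes> (z \<otimes> z0)"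
      unfolding z0_def using y(1) c s g by (simp only: m_ac m_closed)
    then have "(y \<otimes> b\<^sub>s) \<otimes> (y \<otimes> b\<^sub>s) \<otimes> z = t" using y c s g by simp
    then show ?thesis using y(1) g by (metis m_closed)
  qed
  note core = fin Nc oneN E0_def oneE square
  have le: "card E0 \<le> 2 * card N" by (rule card_exceptions_le[OF core])
  have oneN_iff: "N #> x = N \<longleftrightarrow> x \<in> N" if "subgroup N G" "x \<in> carrier G" for x
    using rcoset_eq_iff[OF that(1,2) one_closed] that subgroup.subset[OF that(1)] by simp
  have A_of: "A = (b\<^sub>s \<otimes> s) <# {x \<in> carrier G. N #> x \<in> A'} \<longleftrightarrow>
      (\<forall>x \<in> carrier G. N #> x \<in> A' \<longleftrightarrow> x \<in> A0)"
    using lcoset_preimage_iff[OF A, of "b\<^sub>s \<otimes> s" "{x \<in> carrier G. N #> x \<in> A'}" A0] A0_iff s g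
    by auto
  have B_of: "B = b\<^sub>s <# {x \<in> carrier G. N #> x \<in> B'} \<longleftrightarrow>
      (\<forall>x \<in> carrier G. N #> x \<in> B' \<longleftrightarrow> x \<in> B0)"
    using lcoset_preimage_iff[OF B g, of "{x \<in> carrier G. N #> x \<in> B'}" B0] B0_iff by auto
  have "card E0 = 2 * card N \<longleftrightarrow> subgroup N G \<and> extremal_pair (G Mod N) A' B' \<and>
      A = (b\<^sub>s \<otimes> s) <# {x \<in> carrier G. N #> x \<in> A'} \<and>
      B = b\<^sub>s <# {x \<in> carrier G. N #> x \<in> B'}"
  proof
    assume eq: "card E0 = 2 * card N"
    note per = extremal_exceptions[OF core eq]
    have sub: "subgroup N G" using subgroup_common_periods[OF core] per(1) by simp
    interpret Q: comm_group "G Mod N" by (rule abelian_FactGroup[OF sub])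
    have pB: "inv (y \<otimes> p) \<in> B0 \<longleftrightarrow> inv y \<in> B0" if "p \<in> N" "y \<in> carrier G" for p y
      using that per(1) common_periods_def[OF core] by blast
    have pB': "y \<otimes> p \<in> B0 \<longleftrightarrow> y \<in> B0" if p: "p \<in> N" and y: "y \<in> carrier G" for p y
    proof -
      have "p \<in> carrier G" using p Nc by auto
      then show ?thesis using pB[of "inv p" "inv y"] subgroup.m_inv_closed[OF sub p] y
        by (simp flip: inv_mult)
    qed
    \<comment> \<open>Periodicity passes from \<open>B0\<close> to \<open>A0\<close> by the identity
      at \<open>\<one>\<close>, because \<open>p \<otimes> p \<in> N\<close>.\<close>
    have pA: "y \<otimes> p \<in> A0 \<longleftrightarrow> y \<in> A0" if p: "p \<in> N" and y: "y \<in> carrier G" for p y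
    proof -
      have pc: "p \<in> carrier G" using p Nc by auto
      have ex: "(of_bool (inv x \<in> B0) :: int) = of_bool (x \<notin> A0) + of_bool (x \<otimes> x \<in> N)"
        if "x \<in> carrier G" for x
        using oneE that by (simp add: E0_def exact_at_def)
      have "y \<otimes> p \<otimes> (y \<otimes> p) = (y \<otimes> y) \<otimes> (p \<otimes> p)" using y pc by (simp only: m_ac m_closed)
      moreover have "y \<otimes> y \<otimes> (p \<otimes> p) \<in> N \<longleftrightarrow> y \<otimes> y \<in> N"
      proof
        assume "y \<otimes> y \<otimes> (p \<otimes> p) \<in> N"
        then have "y \<otimes> y \<otimes> (p \<otimes> p) \<otimes> inv (p \<otimes> p) \<in> N"
          using p sub by (meson subgroup.m_closed subgroup.m_inv_closed)
        then show "y \<otimes> y \<in> N" using y pc by simp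
      qed (use p sub in \<open>simp add: subgroup.m_closed\<close>)
      ultimately show ?thesis
        using ex[OF y] ex[of "y \<otimes> p"] pB[OF p y] y pc by (auto simp: of_bool_def split: if_splits)
    qed
    have sat: "N #> x \<in> (\<lambda>g. N #> g) ` U \<longleftrightarrow> x \<in> U"
      if U: "U \<subseteq> carrier G" and pU: "\<And>p y. p \<in> N \<Longrightarrow> y \<in> carrier G \<Longrightarrow> y \<otimes> p \<in> U \<longleftrightarrow> y \<in> U"
        and x: "x \<in> carrier G" for U x
    proof
      assume "N #> x \<in> (\<lambda>g. N #> g) ` U"
      then obtain u where u: "u \<in> U" "N #> x = N #> u" by blast
      then have uc: "u \<in> carrier G" using U by auto
      have "x \<otimes> inv u \<in> N" using rcoset_eq_iff[OF sub x uc] u(2) by blast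
      moreover have "u \<otimes> (x \<otimes> inv u) = x"
        using x uc by (simp add: m_assoc[symmetric])
      ultimately show "x \<in> U" using pU[OF _ uc, of "x \<otimes> inv u"] u by simp
    qed simp
    have sA: "N #> x \<in> A' \<longleftrightarrow> x \<in> A0" if "x \<in> carrier G" for x
      unfolding A'_def by (rule sat[OF A0c pA that])
    have sB: "N #> x \<in> B' \<longleftrightarrow> x \<in> B0" if "x \<in> carrier G" for x
      unfolding B'_def by (rule sat[OF B0c pB' that])
    \<comment> \<open>An exception outside \<open>N\<close> supplies the second, nontrivial class on
      which the structure modulo \<open>N\<close> rests.\<close>
    obtain z where z: "z \<in> E0" "z \<notin> N" using per(2) by blast
    have zc: "z \<in> carrier G" using z by (simp add: E0_def)
    have ex: "exact_at (G Mod N) {\<one>\<^bsub>G Mod N\<^esub>} A' B' (N #> w)" if "w \<in> E0" for w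
      using exact_at_FactGroup[OF sub _ sA sB, of w] that by (auto simp: E0_def)
    have "extremal_pair (G Mod N) A' B'"
    proof (rule Q.exact_pair_extremal[where z = "N #> z"])
      show "finite (carrier (G Mod N))" using fin by (simp add: carrier_FactGroup)
      show "A' \<subseteq> carrier (G Mod N)" "B' \<subseteq> carrier (G Mod N)"
        using A0c B0c by (auto simp: A'_def B'_def carrier_FactGroup)
      show "N #> z \<in> carrier (G Mod N)" using zc by (auto simp: carrier_FactGroup)
      show "N #> z \<noteq> \<one>\<^bsub>G Mod N\<^esub>" using oneN_iff[OF sub zc] z by simp
      show "exact_at (G Mod N) {\<one>\<^bsub>G Mod N\<^esub>} A' B' \<one>\<^bsub>G Mod N\<^esub>"
        using ex[OF oneE] oneN_iff[OF sub one_closed] oneN by simp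
      show "exact_at (G Mod N) {\<one>\<^bsub>G Mod N\<^esub>} A' B' (N #> z)" by (rule ex[OF z(1)])
    qed
    then show "subgroup N G \<and> extremal_pair (G Mod N) A' B' \<and>
      A = (b\<^sub>s \<otimes> s) <# {x \<in> carrier G. N #> x \<in> A'} \<and>
      B = b\<^sub>s <# {x \<in> carrier G. N #> x \<in> B'}"
      using sub sA sB A_of B_of by blast
  next
    assume "subgroup N G \<and> extremal_pair (G Mod N) A' B' \<and>
      A = (b\<^sub>s \<otimes> s) <# {x \<in> carrier G. N #> x \<in> A'} \<and>
      B = b\<^sub>s <# {x \<in> carrier G. N #> x \<in> B'}"
    then have sub: "subgroup N G" and ext: "extremal_pair (G Mod N) A' B'"
      and sA: "\<And>x. x \<in> carrier G \<Longrightarrow> N #> x \<in> A' \<longleftrightarrow> x \<in> A0"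
      and sB: "\<And>x. x \<in> carrier G \<Longrightarrow> N #> x \<in> B' \<longleftrightarrow> x \<in> B0"
      using A_of B_of by blast+
    interpret Q: comm_group "G Mod N" by (rule abelian_FactGroup[OF sub])
    have finQ: "finite (carrier (G Mod N))" using fin by (simp add: carrier_FactGroup)
    have cQ: "A' \<subseteq> carrier (G Mod N)" "B' \<subseteq> carrier (G Mod N)"
      using A0c B0c by (auto simp: A'_def B'_def carrier_FactGroup)
    have "exact_at (G Mod N) {\<one>\<^bsub>G Mod N\<^esub>} A' B' (N #> \<one>)"
      using exact_at_FactGroup[OF sub one_closed sA sB] oneE by (simp add: E0_def)
    then have ex1: "exact_at (G Mod N) {\<one>\<^bsub>G Mod N\<^esub>} A' B' \<one>\<^bsub>G Mod N\<^esub>"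
      using oneN_iff[OF sub one_closed] oneN by simp
    \<comment> \<open>Here \<open>c = inv a\<close>, so with \<open>a \<in> A'\<close> and
      \<open>c \<in> B'\<close> the identity at the unit leaves only
      \<open>a \<otimes> a = \<one>\<close>.\<close>
    have one: "a \<otimes>\<^bsub>G Mod N\<^esub> a = \<one>\<^bsub>G Mod N\<^esub>"
      if ac: "a \<in> A'" "c \<in> B'" "a \<otimes>\<^bsub>G Mod N\<^esub> c = \<one>\<^bsub>G Mod N\<^esub>" for a c
    proof -
      have c: "a \<in> carrier (G Mod N)" "c \<in> carrier (G Mod N)" using ac cQ by auto
      then have "inv\<^bsub>G Mod N\<^esub> a = c"
        using Q.inv_equality[of c a] ac(3) Q.m_comm by metis
      then show ?thesis
        using bspec[OF ex1[unfolded exact_at_def] c(1)] ac(1,2) Q.r_one[OF c(1)]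
          Q.r_one[OF Q.m_closed[OF c(1) c(1)]]
        by (simp only: of_bool_def split: if_splits) simp_all
    qed
    have "\<exists>z' \<in> carrier (G Mod N). z' \<noteq> \<one>\<^bsub>G Mod N\<^esub> \<and>
        (\<forall>a \<in> A'. \<forall>c \<in> B'. a \<otimes>\<^bsub>G Mod N\<^esub> c = z' \<longrightarrow> a = c)"
      by (rule Q.extremal_pair_doubles[OF finQ cQ _ ext]) (rule one)
    then obtain z' where z': "z' \<in> carrier (G Mod N)" "z' \<noteq> \<one>\<^bsub>G Mod N\<^esub>"
      and dbl: "\<And>a c. a \<in> A' \<Longrightarrow> c \<in> B' \<Longrightarrow> a \<otimes>\<^bsub>G Mod N\<^esub> c = z' \<Longrightarrow> a = c"
      by blast
    have dbl1: "a = c" if ac: "a \<in> A'" "c \<in> B'" "a \<otimes>\<^bsub>G Mod N\<^esub> c = \<one>\<^bsub>G Mod N\<^esub>" for a c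
    proof -
      have c: "a \<in> carrier (G Mod N)" "c \<in> carrier (G Mod N)" using ac cQ by auto
      have "a \<otimes>\<^bsub>G Mod N\<^esub> a = a \<otimes>\<^bsub>G Mod N\<^esub> c" using one[OF ac] ac(3) by (simp only:)
      then show ?thesis using c Q.l_cancel by blast
    qed
    obtain z where z: "z \<in> carrier G" "z' = N #> z" using z'(1) by (auto simp: carrier_FactGroup)
    \<comment> \<open>A representation of \<open>w \<otimes> z0\<close> in \<open>A\<close> and
      \<open>B\<close> projects to one of \<open>z'\<close> or of the unit. There the two factors
      agree, so the translated summands differ by an element of \<open>N\<close> and the original
      ones by an element of \<open>S\<close>.\<close>
    have inE: "w \<in> E0" if w: "w \<in> carrier G" "N #> w = z' \<or> N #> w = \<one>\<^bsub>G Mod N\<^esub>" for w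
    proof -
      have "a \<otimes> inv c \<in> S" if ac: "a \<in> A" "c \<in> B" "a \<otimes> c = w \<otimes> z0" for a c
      proof -
        let ?a = "a \<otimes> inv (b\<^sub>s \<otimes> s)" and ?c = "c \<otimes> inv b\<^sub>s"
        have k: "a \<in> carrier G" "c \<in> carrier G" using ac A B by auto
        have kk: "?a \<in> carrier G" "?c \<in> carrier G" using k s g by auto
        have mem: "N #> ?a \<in> A'" "N #> ?c \<in> B'"
          using sA[OF kk(1)] sB[OF kk(2)] A0_iff[OF kk(1)] B0_iff[OF kk(2)] k ac s g by auto
        have "?a \<otimes> ?c = (a \<otimes> c) \<otimes> (inv (b\<^sub>s \<otimes> s) \<otimes> inv b\<^sub>s)"
          using k s g by (simp only: m_ac m_closed inv_closed)
        also have "inv (b\<^sub>s \<otimes> s) \<otimes> inv b\<^sub>s = inv z0"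
          unfolding z0_def using s g by (simp add: inv_mult m_ac)
        finally have "?a \<otimes> ?c = w" unfolding ac(3) using w z0 by simp
        then have "(N #> ?a) \<otimes>\<^bsub>G Mod N\<^esub> (N #> ?c) = N #> w"
          using FactGroup_rcoset(1)[OF sub kk] by simp
        then have "N #> ?a = N #> ?c" using w(2) dbl[OF mem] dbl1[OF mem] by metis
        then have "?a \<otimes> inv ?c \<in> N" using rcoset_eq_iff[OF sub kk] by simp
        then have "?a \<otimes> inv ?c \<otimes> s \<in> S" using N_iff[of "?a \<otimes> inv ?c"] kk by simp
        moreover have "?a \<otimes> inv ?c \<otimes> s = (a \<otimes> inv c) \<otimes> (inv b\<^sub>s \<otimes> b\<^sub>s) \<otimes> (inv s \<otimes> s)"
        proof -
          have "inv ?c = inv c \<otimes> b\<^sub>s" "inv (b\<^sub>s \<otimes> s) = inv b\<^sub>s \<otimes> inv s"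
            using k g s by (simp_all add: inv_mult)
          then show ?thesis using k s g by (simp only: m_ac m_closed inv_closed)
        qed
        ultimately show ?thesis using k s g by simp
      qed
      then have "w \<otimes> z0 \<notin> restricted_sumset G S A B" by (fastforce simp: restricted_sumset_def)
      then have "w \<otimes> z0 \<in> E" using w z0 by (simp add: E_def exceptions_def AB)
      then show ?thesis using E0_iff[OF w(1)] by simp
    qed
    have preimage: "{w \<in> carrier G. N #> w = N #> v} = N #> v" if v: "v \<in> carrier G" for v
    proof -
      have "N #> v \<subseteq> carrier G" using v Nc by (rule r_coset_subset_G[rotated])
      moreover have "N #> w = N #> v \<longleftrightarrow> w \<in> N #> v" if "w \<in> carrier G" for w
        using rcos_self[OF that sub] repr_independence[OF _ v sub, of w] by auto
      ultimately show ?thesis by auto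
    qed
    have one1: "N #> \<one> = N" using oneN_iff[OF sub one_closed] oneN by simp
    \<comment> \<open>The classes of \<open>z\<close> and \<open>\<one>\<close> are disjoint and
      consist of exceptions, so there are at least 2|N| of them, which meets the upper
      bound.\<close>
    have "(N #> z) \<union> N \<subseteq> E0"
      using inE preimage[OF z(1)] preimage[OF one_closed] z(2) unfolding one1 by auto
    moreover have "card ((N #> z) \<union> N) = card (N #> z) + card N"
    proof (rule card_Un_disjoint)
      show "finite (N #> z)" "finite N"
        using fin Nc z(1) r_coset_subset_G finite_subset by metis+
      show "(N #> z) \<inter> N = {}"
        using preimage[OF z(1)] preimage[OF one_closed] z' z(2) unfolding one1 by auto
    qed
    moreover have "card (N #> z) = card N"
      using card_rcosets_equal[OF rcosetsI[OF Nc z(1)] Nc] by simp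
    moreover have "finite E0" using fin by (simp add: E0_def)
    ultimately have "2 * card N \<le> card E0" by (metis card_mono mult_2)
    then show "card E0 = 2 * card N" using le by simp
  qed
  then show ?thesis
    unfolding lhs cardE cardN
    unfolding Let_def extremal_pair_def N_def[symmetric] A0_def[symmetric] B0_def[symmetric]
      A'_def[symmetric] B'_def[symmetric]
    by (simp only: conj_assoc)
qed

end
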